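(* Let $k\colon R\to\mathbb{C}$ be a $W$-invariant multiplicity function with $\operatorname{Re} k_\alpha\ge 0$ for all $\alpha\in R$, let $\lambda\in\mathfrak{a}_{\mathrm{reg}}$ and let $p\in\mathbb{C}[\mathfrak{a}]$. Then there exists a constant $C=C_{R,k,\lambda,p}\ge 0$ such that $$|p(\partial)\operatorname{Exp}_k(i\lambda,x)|\le C\,\big|\Omega_k^{-1/2}(x)\big|\qquad\text{for all } x\in\mathfrak{a},$$ where $p(\partial)$ acts in the $x$-variable.
   Context: $(\mathfrak{a},\langle\cdot,\cdot\rangle)$ is a finite-dimensional Euclidean space; $\langle\cdot,\cdot\rangle$ is extended to a complex bilinear form on $\mathfrak{a}_{\mathbb{C}}=\mathbb{C}\otimes_{\mathbb{R}}\mathfrak{a}$. $R\subseteq\mathfrak{a}$ is a reduced root system spanning $\mathfrak{a}$ (a finite set of nonzero vectors, stable under all its reflections, with $R\cap\mathbb{R}\alpha=\{\pm\alpha\}$; the crystallographic condition is not imposed), normalized by $\langle\alpha,\alpha\rangle=2$ for all $\alpha\in R$. $W$ is the finite reflection group generated by $s_\alpha(x)=x-\langle\alpha,x\rangle\alpha$, $\alpha\in R$. $R_+\subseteq R$ is a fixed set of positive roots. $\mathfrak{a}_{\mathrm{reg}}=\{x\in\mathfrak{a}:\langle\alpha,x\rangle\ne0\ \forall\alpha\in R\}$. $\mathbb{C}[\mathfrak{a}]$ is the algebra of complex polynomial functions on $\mathfrak{a}$; identifying $\mathfrak{a}\cong\mathfrak{a}^*$ via $\langle\cdot,\cdot\rangle$,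 the map $\xi\mapsto\partial_\xi$ (directional derivative) extends to an algebra homomorphism $p\mapsto p(\partial)$ onto the constant coefficient differential operators. For a $W$-invariant $k\colon R\to\mathbb{C}$, the Dunkl operator in direction $\xi\in\mathfrak{a}$ is $T_\xi=\partial_\xi+\sum_{\alpha\in R_+}k_\alpha\langle\alpha,\xi\rangle\frac{1-s_\alpha}{\langle\alpha,\cdot\rangle}$, where $(s_\alpha f)(x)=f(s_\alpha x)$. If $\operatorname{Re}k\ge0$, the Dunkl kernel $\operatorname{Exp}_k\colon\mathfrak{a}_{\mathbb{C}}\times\mathfrak{a}_{\mathbb{C}}\to\mathbb{C}$ is the unique holomorphic function such that for every $\lambda\in\mathfrak{a}_{\mathbb{C}}$, $f=\operatorname{Exp}_k(\lambda,\cdot)$ is the unique solution of $T_\xi f=\langle\xi,\lambda\rangle f$ for all $\xi\in\mathfrak{a}$, $f(0)=1$. $\Omega_k^{-1/2}(x)=\prod_{\alpha\in R_+}(1+|\langle\alpha,x\rangle|)^{-k_\alpha}$ for $x\in\mathfrak{a}$. *)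

theory Defs
  imports "HOL-Analysis.Analysis"
begin

section \<open>Complexification\<close>

text \<open>The complexification of \<open>'a\<close> is \<open>'a \<times> 'a\<close>, where \<open>(x, y)\<close> stands for \<open>x + i y\<close>.\<close>

type_synonym 'a complexification = "'a \<times> 'a"

definition cplx_of :: "'a::euclidean_space \<Rightarrow> 'a complexification" where
  "cplx_of x = (x, 0)"

definition cscale :: "complex \<Rightarrow> 'a::euclidean_space complexification \<Rightarrow> 'a complexification" where
  "cscale c z = (Re c *\<^sub>R fst z - Im c *\<^sub>R snd z, Re c *\<^sub>R snd z + Im c *\<^sub>R fst z)"

text \<open>The complex bilinear (not sesquilinear) extension of the inner product.\<close>

definition cform :: "'a::euclidean_space complexification \<Rightarrow> 'a complexification \<Rightarrow> complex" where
  "cform z w = Complex (fst z \<bullet> fst w - snd z \<bullet> snd w) (fst z \<bullet> snd w + snd z \<bullet> fst w)"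

text \<open>
  Holomorphy in several variables: total differentiability with a complex linear derivative,
  where \<open>J\<close> is multiplication by the imaginary unit on the domain.
\<close>

definition holo_wrt :: "('b::real_normed_vector \<Rightarrow> 'b) \<Rightarrow> ('b \<Rightarrow> complex) \<Rightarrow> bool" where
  "holo_wrt J F \<longleftrightarrow> (\<forall>z. \<exists>F'. (F has_derivative F') (at z) \<and> (\<forall>u. F' (J u) = \<i> * F' u))"

definition entire :: "('a::euclidean_space complexification \<Rightarrow> complex) \<Rightarrow> bool" where
  "entire f \<longleftrightarrow> holo_wrt (cscale \<i>) f"

definition entire2 ::
  "('a::euclidean_space complexification \<Rightarrow> 'a complexification \<Rightarrow> complex) \<Rightarrow> bool" where
  "entire2 F \<longleftrightarrow> holo_wrt (map_prod (cscale \<i>) (cscale \<i>)) (\<lambda>(z, w). F z w)"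

section \<open>Root systems\<close>

text \<open>The orthogonal reflection in the hyperplane perpendicular to \<open>\<alpha>\<close>, provided \<open>\<alpha> \<bullet> \<alpha> = 2\<close>.\<close>

definition root_refl :: "'a::euclidean_space \<Rightarrow> 'a \<Rightarrow> 'a" where
  "root_refl \<alpha> x = x - (\<alpha> \<bullet> x) *\<^sub>R \<alpha>"

definition normalized_root_system :: "'a::euclidean_space set \<Rightarrow> bool" where
  "normalized_root_system R \<longleftrightarrow>
     finite R \<and> 0 \<notin> R \<and> span R = UNIV \<and>
     (\<forall>\<alpha>\<in>R. root_refl \<alpha> ` R = R) \<and>
     (\<forall>\<alpha>\<in>R. R \<inter> range (\<lambda>t. t *\<^sub>R \<alpha>) = {\<alpha>, - \<alpha>}) \<and>
     (\<forall>\<alpha>\<in>R. \<alpha> \<bullet> \<alpha> = 2)"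

text \<open>The reflections are involutions, so the monoid they generate is the reflection group.\<close>

inductive_set reflection_group :: "'a::euclidean_space set \<Rightarrow> ('a \<Rightarrow> 'a) set"
  for R :: "'a set" where
  id: "id \<in> reflection_group R"
| comp: "\<alpha> \<in> R \<Longrightarrow> w \<in> reflection_group R \<Longrightarrow> root_refl \<alpha> \<circ> w \<in> reflection_group R"

definition regular :: "'a::euclidean_space set \<Rightarrow> 'a set" where
  "regular R = {x. \<forall>\<alpha>\<in>R. \<alpha> \<bullet> x \<noteq> 0}"

definition positive_roots :: "'a::euclidean_space set \<Rightarrow> 'a set \<Rightarrow> bool" where
  "positive_roots R Rpos \<longleftrightarrow> (\<exists>v\<in>regular R. Rpos = {\<alpha>\<in>R. \<alpha> \<bullet> v > 0})"

text \<open>Multiplicity functions are total; only their values on \<open>R\<close> matter.\<close>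

definition multiplicity_function :: "'a::euclidean_space set \<Rightarrow> ('a \<Rightarrow> complex) \<Rightarrow> bool" where
  "multiplicity_function R k \<longleftrightarrow> (\<forall>w\<in>reflection_group R. \<forall>\<alpha>\<in>R. k (w \<alpha>) = k \<alpha>)"

definition Omega_neg_half :: "'a::euclidean_space set \<Rightarrow> ('a \<Rightarrow> complex) \<Rightarrow> 'a \<Rightarrow> complex" where
  "Omega_neg_half Rpos k x = (\<Prod>\<alpha>\<in>Rpos. complex_of_real (1 + \<bar>\<alpha> \<bullet> x\<bar>) powr (- k \<alpha>))"

section \<open>Differential operators with constant coefficients\<close>

definition dir_deriv :: "'b::real_normed_vector \<Rightarrow> ('b \<Rightarrow> complex) \<Rightarrow> 'b \<Rightarrow> complex" where
  "dir_deriv \<xi> f x = vector_derivative (\<lambda>t::real. f (x + t *\<^sub>R \<xi>)) (at 0)"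

text \<open>
  \<open>symbol_op p D\<close> says that \<open>D\<close> is the operator \<open>p(\<partial>)\<close>: this is the graph of the algebra
  homomorphism that sends the linear form \<open>\<langle>\<xi>, \<cdot>\<rangle>\<close> to \<open>\<partial>\<^sub>\<xi>\<close>. A polynomial function may be
  related to several operators on arbitrary functions (partial derivatives need not commute),
  but these agree on smooth functions.
\<close>

inductive symbol_op ::
  "('a::euclidean_space \<Rightarrow> complex) \<Rightarrow> (('a \<Rightarrow> complex) \<Rightarrow> 'a \<Rightarrow> complex) \<Rightarrow> bool" where
  const: "symbol_op (\<lambda>x. c) (\<lambda>f x. c * f x)"
| linear: "symbol_op (\<lambda>x. complex_of_real (\<xi> \<bullet> x)) (dir_deriv \<xi>)"
| add: "symbol_op p D \<Longrightarrow> symbol_op q D' \<Longrightarrow> symbol_op (\<lambda>x. p x + q x) (\<lambda>f x. D f x + D' f x)"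
| mult: "symbol_op p D \<Longrightarrow> symbol_op q D' \<Longrightarrow> symbol_op (\<lambda>x. p x * q x) (\<lambda>f. D (D' f))"

lemma real_polynomial_function_symbol_op:
  assumes "real_polynomial_function p"
  shows "\<exists>D. symbol_op (\<lambda>x. complex_of_real (p x)) D"
  using assms
proof induction
  case (linear f)
  interpret bounded_linear f by fact
  have "f x = (\<Sum>b\<in>Basis. f b *\<^sub>R b) \<bullet> x" for x
  proof -
    have "f x = f (\<Sum>b\<in>Basis. (x \<bullet> b) *\<^sub>R b)"
      by (simp only: euclidean_representation)
    also have "\<dots> = (\<Sum>b\<in>Basis. (x \<bullet> b) * f b)"
      by (simp add: sum scaleR)
    also have "\<dots> = x \<bullet> (\<Sum>b\<in>Basis. f b *\<^sub>R b)"
      by (simp add: inner_sum_right mult.commute)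
    also have "\<dots> = (\<Sum>b\<in>Basis. f b *\<^sub>R b) \<bullet> x"
      by (rule inner_commute)
    finally show ?thesis .
  qed
  then have "f = (\<lambda>x. (\<Sum>b\<in>Basis. f b *\<^sub>R b) \<bullet> x)" ..
  then show ?case
    using symbol_op.linear by metis
next
  case (const c)
  show ?case using symbol_op.const by blast
next
  case (add f g)
  then show ?case unfolding of_real_add using symbol_op.add by blast
next
  case (mult f g)
  then show ?case unfolding of_real_mult using symbol_op.mult by blast
qed

lemma polynomial_function_iff_symbol_op:
  "polynomial_function p \<longleftrightarrow> (\<exists>D. symbol_op p D)"
proof
  assume "polynomial_function p"
  then have "real_polynomial_function (\<lambda>x. Re (p x))" "real_polynomial_function (\<lambda>x. Im (p x))"
    by (auto simp: polynomial_function_def o_def bounded_linear_Re bounded_linear_Im)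
  then obtain D1 D2 where
    "symbol_op (\<lambda>x. complex_of_real (Re (p x))) D1" "symbol_op (\<lambda>x. complex_of_real (Im (p x))) D2"
    using real_polynomial_function_symbol_op by blast
  then have "\<exists>D. symbol_op (\<lambda>x. complex_of_real (Re (p x)) + \<i> * complex_of_real (Im (p x))) D"
    using symbol_op.add[OF _ symbol_op.mult[OF symbol_op.const]] by blast
  then show "\<exists>D. symbol_op p D"
    by (simp flip: complex_eq)
next
  assume "\<exists>D. symbol_op p D"
  then obtain D where "symbol_op p D" ..
  then have "real_polynomial_function (\<lambda>x. Re (p x)) \<and> real_polynomial_function (\<lambda>x. Im (p x))"
  proof induction
    case (linear \<xi>)
    then show ?case
      by (simp add: real_polynomial_function.intros bounded_linear_inner_right)
  next
    case (const c)
    show ?case by (simp add: real_polynomial_function.intros(2))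
  next
    case (add p D q D')
    then show ?case by (simp add: real_polynomial_function.intros(3))
  next
    case (mult p D q D')
    then show ?case
      by (simp add: real_polynomial_function.intros(3,4) real_polynomial_function_diff)
  qed
  then have "polynomial_function (\<lambda>x. Re (p x) *\<^sub>R 1 + Im (p x) *\<^sub>R \<i>)"
    by (intro polynomial_function_add polynomial_function_mult polynomial_function_const)
       (simp_all add: real_polynomial_function_eq)
  moreover have "(\<lambda>x. Re (p x) *\<^sub>R 1 + Im (p x) *\<^sub>R \<i>) = p"
    by (simp add: fun_eq_iff complex_eq_iff)
  ultimately show "polynomial_function p"
    by simp
qed

section \<open>Dunkl operators and the Dunkl kernel\<close>

definition root_crefl ::
  "'a::euclidean_space \<Rightarrow> 'a complexification \<Rightarrow> 'a complexification" where
  "root_crefl \<alpha> z = z - cscale (cform (cplx_of \<alpha>) z) (cplx_of \<alpha>)"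

text \<open>
  The quotient \<open>(1 - s\<^sub>\<alpha>) f / \<langle>\<alpha>, \<cdot>\<rangle>\<close>, continued across the hyperplane \<open>\<langle>\<alpha>, z\<rangle> = 0\<close>,
  where its value is \<open>lim (f (z + t \<alpha>) - f (z - t \<alpha>)) / (2 t)\<close> since \<open>\<alpha> \<bullet> \<alpha> = 2\<close>.
\<close>

definition refl_quotient ::
  "'a::euclidean_space \<Rightarrow> ('a complexification \<Rightarrow> complex) \<Rightarrow> 'a complexification \<Rightarrow> complex" where
  "refl_quotient \<alpha> f z =
     (if cform (cplx_of \<alpha>) z = 0 then dir_deriv (cplx_of \<alpha>) f z
      else (f z - f (root_crefl \<alpha> z)) / cform (cplx_of \<alpha>) z)"

definition dunkl_op ::
  "'a::euclidean_space set \<Rightarrow> ('a \<Rightarrow> complex) \<Rightarrow> 'a \<Rightarrow>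
   ('a complexification \<Rightarrow> complex) \<Rightarrow> 'a complexification \<Rightarrow> complex" where
  "dunkl_op Rpos k \<xi> f z =
     dir_deriv (cplx_of \<xi>) f z +
     (\<Sum>\<alpha>\<in>Rpos. k \<alpha> * complex_of_real (\<alpha> \<bullet> \<xi>) * refl_quotient \<alpha> f z)"

definition dunkl_eigenfunction ::
  "'a::euclidean_space set \<Rightarrow> ('a \<Rightarrow> complex) \<Rightarrow> 'a complexification \<Rightarrow>
   ('a complexification \<Rightarrow> complex) \<Rightarrow> bool" where
  "dunkl_eigenfunction Rpos k \<mu> f \<longleftrightarrow>
     entire f \<and> f 0 = 1 \<and> (\<forall>\<xi> z. dunkl_op Rpos k \<xi> f z = cform (cplx_of \<xi>) \<mu> * f z)"

text \<open>At most one function \<open>E\<close> satisfies this; for \<open>Re k \<ge> 0\<close> it exists.\<close>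

definition is_dunkl_kernel ::
  "'a::euclidean_space set \<Rightarrow> ('a \<Rightarrow> complex) \<Rightarrow>
   ('a complexification \<Rightarrow> 'a complexification \<Rightarrow> complex) \<Rightarrow> bool" where
  "is_dunkl_kernel Rpos k E \<longleftrightarrow>
     entire2 E \<and>
     (\<forall>\<mu>. dunkl_eigenfunction Rpos k \<mu> (E \<mu>) \<and> (\<forall>f. dunkl_eigenfunction Rpos k \<mu> f \<longrightarrow> f = E \<mu>))"

end

theory Submission
  imports Defs "HOL-Complex_Analysis.Complex_Analysis"
begin

text \<open>
  The translates \<open>F\<^sub>w(x) = Exp\<^sub>k(i\<mu>, w x)\<close>, \<open>w \<in> W\<close>, solve a linear first order system whose
  coefficients are singular on the walls. Along a ray \<open>x + s e\<close> in the closed positive chamber the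
  energy \<open>\<Sum>\<^sub>w |F\<^sub>w|\<^sup>2\<close> does not increase, since \<open>Re k \<ge> 0\<close>. For large \<open>s\<close>, multiplication by
  \<open>\<Prod> \<langle>\<beta>, \<cdot>\<rangle>\<^bsup>k\<^esup>\<close> over the roots \<open>\<beta>\<close> with \<open>\<langle>\<beta>, e\<rangle> > 0\<close> and removal of the phases leaves couplings of
  size \<open>1/s\<close> that oscillate with nonzero frequencies because \<open>\<mu>\<close> is regular; one integration by
  parts makes them integrable. So the weighted sum \<open>|\<Omega>\<^bsup>1/2\<^esup>| \<Sum>\<^sub>w |F\<^sub>w|\<close> grows by at most a constant
  factor along the ray, uniformly in its starting point, and since the chamber is a finitely generated
  cone, finitely many such rays lead from \<open>0\<close> to any of its points. The bound is extended to a complex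
  tube around \<open>\<aa>\<close>, where Cauchy's inequality controls all derivatives.
\<close>

section \<open>Complexification\<close>

text \<open>The Dunkl equation is nonlocal, and only the family of all translates closes up to a
  finite system. The energy estimate tolerates the singular walls but yields mere boundedness. Decay
  comes from the diagonal coefficients \<open>- k \<beta> * r \<beta> s\<close> with \<open>r
  \<beta> s = (\<beta> \<bullet> e) / (\<beta> \<bullet> x + (\<beta> \<bullet> e) * s)\<close>:
  they are logarithmic derivatives, so a scalar factor removes them exactly, also for complex
  \<open>k\<close>. The couplings left over have a logarithmically divergent integral, and a
  Gronwall estimate would lose a power of \<open>s\<close>; hence the need for oscillation.
  Uniformity rests on \<open>r \<beta> s \<le> 1 / s\<close>, valid for every \<open>x\<close> in
  the chamber: the time from which oscillation wins depends on \<open>e\<close> but not on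
  \<open>x\<close>. Up to that time the energy estimate suffices, even if \<open>x\<close> lies on a
  wall. Roots orthogonal to \<open>e\<close> drop out of the equation, and their weight factors are
  constant on the ray. This is what permits rays to be chained. Differentiation costs only a
  constant because the logarithm of the weight is Lipschitz, but Cauchy's inequality needs a tube of
  uniform width, also near the walls.\<close>

lemma cscale_add_left: "cscale (a + b) z = cscale a z + cscale b z"
  and cscale_zero [simp]: "cscale 0 z = 0"
  and cscale_of_real: "cscale (complex_of_real t) z = t *\<^sub>R z"
  by (simp_all add: cscale_def prod_eq_iff algebra_simps)

lemma cscale_cplx_of: "cscale c (cplx_of x) = (Re c *\<^sub>R x, Im c *\<^sub>R x)"
  by (simp add: cscale_def cplx_of_def)

lemma complexification_decomp: "z = cplx_of (fst z) + cscale \<i> (cplx_of (snd z))"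
  by (simp add: cscale_def cplx_of_def prod_eq_iff)

lemma continuous_on_cscale [continuous_intros]:
  "continuous_on S c \<Longrightarrow> continuous_on S f \<Longrightarrow> continuous_on S (\<lambda>x. cscale (c x) (f x))"
  unfolding cscale_def by (intro continuous_intros)

lemma bounded_linear_cscale: "bounded_linear (\<lambda>c. cscale c u)"
  by (rule linear_conv_bounded_linear[THEN iffD1], rule linearI)
     (simp_all add: cscale_add_left, simp add: cscale_def algebra_simps)

lemma norm_snd_cscale_le: "norm (snd (cscale c u)) \<le> norm c * (norm (fst u) + norm (snd u))"
  and norm_fst_cscale_le: "norm (fst (cscale c u)) \<le> norm c * (norm (fst u) + norm (snd u))"
proof -
  have *: "norm (a *\<^sub>R x + b *\<^sub>R y) \<le> norm c * (norm x + norm y)"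
    if "\<bar>a\<bar> \<le> norm c" "\<bar>b\<bar> \<le> norm c" for a b and x y :: 'a
    by (rule order_trans[OF norm_triangle_ineq]) (simp add: distrib_left add_mono mult_right_mono that)
  show "norm (snd (cscale c u)) \<le> norm c * (norm (fst u) + norm (snd u))"
    using *[of "Im c" "Re c" "fst u" "snd u"] abs_Re_le_cmod[of c] abs_Im_le_cmod[of c]
    by (simp add: cscale_def add.commute)
  show "norm (fst (cscale c u)) \<le> norm c * (norm (fst u) + norm (snd u))"
    using *[of "Re c" "- Im c" "fst u" "snd u"] abs_Re_le_cmod[of c] abs_Im_le_cmod[of c]
    by (simp add: cscale_def)
qed

lemma cform_add_left: "cform (z + w) u = cform z u + cform w u"
  and cform_add_right: "cform u (z + w) = cform u z + cform u w"
  and cform_cscale_left: "cform (cscale c z) u = c * cform z u"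
  and cform_cscale_right: "cform u (cscale c z) = c * cform u z"
  by (simp_all add: cform_def cscale_def complex_eq_iff algebra_simps)

lemma cform_cplx_of: "cform (cplx_of a) (cplx_of x) = complex_of_real (a \<bullet> x)"
  and Re_cform_cplx_of: "Re (cform (cplx_of a) z) = a \<bullet> fst z"
  and Im_cform_cplx_of: "Im (cform (cplx_of a) z) = a \<bullet> snd z"
  by (simp_all add: cform_def cplx_of_def complex_eq_iff)

lemma cform_uminus_left: "cform (cplx_of (- a)) z = - cform (cplx_of a) z"
  by (simp add: cform_def cplx_of_def complex_eq_iff)

section \<open>Directional derivatives of entire functions\<close>

text \<open>Holomorphy on complex lines together with continuity passes to derivatives directly
  through the Cauchy integral, whereas total differentiability of a derivative would take a further
  argument.\<close>

definition gateaux_entire :: "('a::euclidean_space complexification \<Rightarrow> complex) \<Rightarrow> bool" where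
  "gateaux_entire f \<longleftrightarrow>
     continuous_on UNIV f \<and> (\<forall>z u. (\<lambda>\<zeta>. f (z + cscale \<zeta> u)) holomorphic_on UNIV)"

definition line_deriv ::
  "'a::euclidean_space complexification \<Rightarrow> ('a complexification \<Rightarrow> complex) \<Rightarrow> 'a complexification \<Rightarrow> complex" where
  "line_deriv u f z = deriv (\<lambda>\<zeta>. f (z + cscale \<zeta> u)) 0"

lemma gateaux_entire_holomorphic:
  "gateaux_entire f \<Longrightarrow> (\<lambda>\<zeta>. f (z + cscale \<zeta> u)) holomorphic_on UNIV"
  unfolding gateaux_entire_def by blast

lemma gateaux_entire_compose_continuous:
  assumes "gateaux_entire f" "continuous_on S g"
  shows "continuous_on S (\<lambda>x. f (g x))"
  using assms continuous_on_compose2[of UNIV f S g] by (auto simp: gateaux_entire_def)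

lemma gateaux_entire_field_derivative:
  assumes "gateaux_entire f"
  shows "((\<lambda>\<zeta>. f (z + cscale \<zeta> u)) has_field_derivative line_deriv u f (z + cscale \<zeta> u)) (at \<zeta>)"
proof -
  have "(\<lambda>\<eta>. f (z + cscale \<zeta> u + cscale \<eta> u)) holomorphic_on UNIV"
    by (intro gateaux_entire_holomorphic assms)
  then have "((\<lambda>\<eta>. f (z + cscale \<zeta> u + cscale \<eta> u)) has_field_derivative
      line_deriv u f (z + cscale \<zeta> u)) (at 0)"
    unfolding line_deriv_def by (rule holomorphic_derivI) auto
  then have "((\<lambda>\<eta>. f (z + cscale (\<eta> + \<zeta>) u)) has_field_derivative
      line_deriv u f (z + cscale \<zeta> u)) (at 0)"
    by (simp add: cscale_add_left add_ac)
  then show ?thesis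
    using DERIV_shift[of "\<lambda>\<eta>. f (z + cscale \<eta> u)" _ 0 \<zeta>] by simp
qed

text \<open>Cauchy's formula on the unit circle writes the derivative as a parameter integral over
  values of \<open>f\<close>, so continuity and holomorphy in \<open>z\<close> follow from theorems
  on such integrals.\<close>

lemma line_deriv_eq_integral:
  assumes "gateaux_entire f"
  shows "line_deriv u f z = integral (cbox 0 (1::real))
    (\<lambda>t. f (z + cscale (exp (2 * pi * \<i> * t)) u) * exp (- (2 * pi * \<i> * t)))"
proof -
  let ?g = "\<lambda>\<zeta>. f (z + cscale \<zeta> u)"
  have hol: "?g holomorphic_on UNIV"
    by (intro gateaux_entire_holomorphic assms)
  have "((\<lambda>w. ?g w / (w - 0) ^ Suc 1) has_contour_integral
      ((2 * pi * \<i>) / fact 1 * (deriv ^^ 1) ?g 0)) (circlepath 0 1)"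
    by (rule Cauchy_has_contour_integral_higher_derivative_circlepath)
       (auto intro: holomorphic_on_subset[OF hol] holomorphic_on_imp_continuous_on)
  then have "((\<lambda>t. ?g (circlepath 0 1 t) / circlepath 0 1 t ^ 2 *
      vector_derivative (circlepath 0 1) (at t within {0..1})) has_integral
      (2 * pi * \<i>) * line_deriv u f z) {0..1}"
    by (simp add: has_contour_integral_def line_deriv_def power2_eq_square)
  then have "((\<lambda>t::real. (2 * pi * \<i>) * (?g (exp (2 * pi * \<i> * t)) * exp (- (2 * pi * \<i> * t)))) has_integral
      (2 * pi * \<i>) * line_deriv u f z) {0..1}"
    by (rule has_integral_eq[rotated])
       (simp add: vector_derivative_circlepath01, simp add: circlepath power2_eq_square exp_minus field_simps)
  then have "((\<lambda>t::real. inverse (2 * pi * \<i>) * ((2 * pi * \<i>) * (?g (exp (2 * pi * \<i> * t)) * exp (- (2 * pi * \<i> * t)))))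
      has_integral inverse (2 * pi * \<i>) * ((2 * pi * \<i>) * line_deriv u f z)) {0..1}"
    by (rule has_integral_mult_right)
  then show ?thesis
    by (simp add: field_simps integral_unique)
qed

lemma continuous_line_deriv:
  assumes "gateaux_entire f"
  shows "continuous_on UNIV (\<lambda>z. line_deriv u f z)"
proof -
  have "continuous_on UNIV (\<lambda>z. integral (cbox 0 (1::real))
    (\<lambda>t. f (z + cscale (exp (2 * pi * \<i> * t)) u) * exp (- (2 * pi * \<i> * t))))"
    by (rule integral_continuous_on_param, unfold split_def)
       (intro continuous_intros gateaux_entire_compose_continuous[OF assms])
  then show ?thesis
    unfolding line_deriv_eq_integral[OF assms] .
qed

lemma gateaux_entire_line_deriv:
  assumes f: "gateaux_entire f"
  shows "gateaux_entire (line_deriv u f)"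
  unfolding gateaux_entire_def
proof (intro conjI allI)
  fix z v
  have cont: "continuous_on S (\<lambda>x. line_deriv v f (g x))" if "continuous_on S g"
    for S :: "(complex \<times> real) set" and g
    using continuous_on_compose2[OF continuous_line_deriv[OF f] that] by auto
  have "(\<lambda>\<eta>. integral (cbox 0 (1::real))
      (\<lambda>t. f (z + cscale \<eta> v + cscale (exp (2 * pi * \<i> * t)) u) * exp (- (2 * pi * \<i> * t))))
      holomorphic_on UNIV"
  proof (rule leibniz_rule_holomorphic)
    fix \<eta> and t :: real
    show "((\<lambda>\<eta>. f (z + cscale \<eta> v + cscale (exp (2 * pi * \<i> * t)) u) * exp (- (2 * pi * \<i> * t)))
      has_field_derivative (line_deriv v f (z + cscale \<eta> v + cscale (exp (2 * pi * \<i> * t)) u)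
        * exp (- (2 * pi * \<i> * t)))) (at \<eta> within UNIV)"
      using DERIV_cmult_right[OF gateaux_entire_field_derivative[OF f,
          of "z + cscale (exp (2 * pi * \<i> * t)) u" v \<eta>]]
      by (simp add: add_ac)
    show "(\<lambda>t. f (z + cscale \<eta> v + cscale (exp (2 * pi * \<i> * complex_of_real t)) u) *
          exp (- (2 * pi * \<i> * complex_of_real t))) integrable_on cbox 0 1"
      by (rule integrable_continuous)
         (intro continuous_intros gateaux_entire_compose_continuous[OF f])
  next
    show "continuous_on (UNIV \<times> cbox 0 1)
     (\<lambda>(\<eta>, t). line_deriv v f (z + cscale \<eta> v + cscale (exp (2 * pi * \<i> * complex_of_real t)) u) *
           exp (- (2 * pi * \<i> * complex_of_real t)))"
      unfolding split_def by (intro continuous_intros cont)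
  qed auto
  then show "(\<lambda>\<eta>. line_deriv u f (z + cscale \<eta> v)) holomorphic_on UNIV"
    by (simp add: line_deriv_eq_integral[OF f])
qed (rule continuous_line_deriv[OF f])

lemma gateaux_entire_add:
  "gateaux_entire f \<Longrightarrow> gateaux_entire g \<Longrightarrow> gateaux_entire (\<lambda>z. f z + g z)"
  and gateaux_entire_cmult: "gateaux_entire f \<Longrightarrow> gateaux_entire (\<lambda>z. c * f z)"
  unfolding gateaux_entire_def by (auto intro!: continuous_intros holomorphic_intros)

lemma dir_deriv_eq_line_deriv:
  assumes "gateaux_entire f"
  shows "dir_deriv u f z = line_deriv u f z"
  unfolding dir_deriv_def
proof (rule vector_derivative_at)
  show "((\<lambda>t::real. f (z + t *\<^sub>R u)) has_vector_derivative line_deriv u f z) (at 0)"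
    using has_vector_derivative_real_field[where a = 0,
        OF gateaux_entire_field_derivative[OF assms, of z u "of_real 0"]]
    by (simp add: cscale_of_real)
qed

lemma dir_deriv_cplx_of:
  "dir_deriv \<xi> (\<lambda>y. f (cplx_of y)) x = dir_deriv (cplx_of \<xi>) f (cplx_of x)"
  by (simp add: dir_deriv_def cplx_of_def)

lemma norm_line_deriv_le:
  assumes "gateaux_entire f" "0 < r" and B: "\<And>\<zeta>. norm \<zeta> = r \<Longrightarrow> norm (f (z + cscale \<zeta> u)) \<le> B"
  shows "norm (line_deriv u f z) \<le> B / r"
proof -
  have hol: "(\<lambda>\<zeta>. f (z + cscale \<zeta> u)) holomorphic_on UNIV"
    by (intro gateaux_entire_holomorphic assms)
  have "norm ((deriv ^^ 1) (\<lambda>\<zeta>. f (z + cscale \<zeta> u)) 0) \<le> fact 1 * B / r ^ 1"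
    using B \<open>0 < r\<close> hol
    by (intro Cauchy_inequality holomorphic_on_imp_continuous_on)
       (auto intro: holomorphic_on_subset)
  then show ?thesis by (simp add: line_deriv_def)
qed

lemma entire_imp_complex_linear_derivative:
  assumes "entire f"
  obtains F' where "(f has_derivative F') (at z)" "\<And>c u. F' (cscale c u) = c * F' u"
proof -
  obtain F' where F': "(f has_derivative F') (at z)" and J: "\<And>u. F' (cscale \<i> u) = \<i> * F' u"
    using assms unfolding entire_def holo_wrt_def by metis
  interpret F': bounded_linear F' by (rule has_derivative_bounded_linear[OF F'])
  have "F' (cscale c u) = c * F' u" for c u
  proof -
    have "cscale c u = Re c *\<^sub>R u + Im c *\<^sub>R cscale \<i> u"
      by (simp add: cscale_def prod_eq_iff)
    then have "F' (cscale c u) = Re c *\<^sub>R F' u + Im c *\<^sub>R (\<i> * F' u)"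
      by (simp only: F'.add F'.scaleR J)
    also have "\<dots> = c * F' u"
      by (simp add: complex_eq_iff)
    finally show ?thesis .
  qed
  with F' show ?thesis by (rule that)
qed

lemma has_field_derivative_on_line:
  assumes "(f has_derivative F') (at (w + cscale \<zeta> u))" "\<And>c u. F' (cscale c u) = c * F' u"
  shows "((\<lambda>\<zeta>. f (w + cscale \<zeta> u)) has_field_derivative F' u) (at \<zeta>)"
proof -
  have "((\<lambda>\<zeta>. w + cscale \<zeta> u) has_derivative (\<lambda>c. cscale c u)) (at \<zeta>)"
    using has_derivative_add[OF has_derivative_const[of w]
        bounded_linear_imp_has_derivative[OF bounded_linear_cscale[of u]]] by simp
  then have "((\<lambda>\<zeta>. f (w + cscale \<zeta> u)) has_derivative (\<lambda>c. F' (cscale c u))) (at \<zeta>)"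
    using assms(1) by (rule has_derivative_compose)
  then show ?thesis
    unfolding has_field_derivative_def assms(2) mult.commute[of "F' u"] .
qed

lemma entire_imp_gateaux_entire:
  assumes f: "entire f"
  shows "gateaux_entire f"
  unfolding gateaux_entire_def
proof (intro conjI allI)
  show "continuous_on UNIV f"
    using entire_imp_complex_linear_derivative[OF f] has_derivative_continuous
    by (metis continuous_at_imp_continuous_on)
  show "(\<lambda>\<zeta>. f (z + cscale \<zeta> u)) holomorphic_on UNIV" for z u
  proof (rule holomorphic_onI)
    fix \<zeta>
    obtain F' where "(f has_derivative F') (at (z + cscale \<zeta> u))"
      "\<And>c u. F' (cscale c u) = c * F' u"
      by (rule entire_imp_complex_linear_derivative[OF f], blast)
    then show "(\<lambda>\<zeta>. f (z + cscale \<zeta> u)) field_differentiable at \<zeta> within UNIV"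
      using has_field_derivative_on_line unfolding field_differentiable_def by blast
  qed
qed

lemma entire_has_derivative:
  assumes f: "entire f"
  shows "(f has_derivative (\<lambda>u. line_deriv u f z)) (at z)"
proof -
  obtain F' where F': "(f has_derivative F') (at z)" "\<And>c u. F' (cscale c u) = c * F' u"
    by (rule entire_imp_complex_linear_derivative[OF f], blast)
  have "line_deriv u f z = F' u" for u
    unfolding line_deriv_def
    by (rule DERIV_imp_deriv, rule has_field_derivative_on_line) (use F' in simp_all)
  with F' show ?thesis by presburger
qed

lemma line_deriv_cscale: "entire f \<Longrightarrow> line_deriv (cscale c u) f z = c * line_deriv u f z"
proof -
  assume f: "entire f"
  obtain F' where F': "(f has_derivative F') (at z)" "\<And>c u. F' (cscale c u) = c * F' u"
    by (rule entire_imp_complex_linear_derivative[OF f], blast)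
  then have "(\<lambda>u. line_deriv u f z) = F'"
    using has_derivative_unique[OF entire_has_derivative[OF f]] by simp
  with F' show ?thesis by metis
qed

lemma continuous_on_has_vector_derivative:
  "(\<And>x. x \<in> S \<Longrightarrow> (f has_vector_derivative f' x) (at x)) \<Longrightarrow> continuous_on S f"
  by (meson continuous_at_imp_continuous_on has_vector_derivative_continuous)

section \<open>Energy estimates for linear systems\<close>

lemma sum_power2_le_power2_sum:
  fixes f :: "'i \<Rightarrow> real"
  assumes "finite I" "\<And>i. i \<in> I \<Longrightarrow> f i \<ge> 0"
  shows "(\<Sum>i\<in>I. (f i)\<^sup>2) \<le> (\<Sum>i\<in>I. f i)\<^sup>2"
proof -
  have "(\<Sum>i\<in>I. (f i)\<^sup>2) \<le> (\<Sum>i\<in>I. f i * (\<Sum>i\<in>I. f i))"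
    unfolding power2_eq_square
    by (intro sum_mono mult_left_mono member_le_sum) (use assms in auto)
  then show ?thesis by (simp add: power2_eq_square sum_distrib_right)
qed

text \<open>Gronwall's inequality for the sum of squares. The derivative is required only inside the
  interval, since the system may be singular at the initial time, when a ray starts on a wall. The
  factor \<open>card I\<close> pays for comparing the sum of norms with the sum of squares.\<close>

lemma energy_growth:
  fixes g g' :: "'i \<Rightarrow> real \<Rightarrow> complex" and T L :: real
  assumes I: "finite I" and T: "0 \<le> T"
    and cont: "\<And>w. w \<in> I \<Longrightarrow> continuous_on {0..T} (g w)"
    and deriv: "\<And>w s. w \<in> I \<Longrightarrow> 0 < s \<Longrightarrow> s < T \<Longrightarrow> (g w has_vector_derivative g' w s) (at s)"
    and growth: "\<And>s. 0 < s \<Longrightarrow> s < T \<Longrightarrow>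
      Re (\<Sum>w\<in>I. cnj (g w s) * g' w s) \<le> L * (\<Sum>w\<in>I. (norm (g w s))\<^sup>2)"
  shows "(\<Sum>w\<in>I. norm (g w T)) \<le> card I * exp (L * T) * (\<Sum>w\<in>I. norm (g w 0))"
proof -
  let ?N = "\<lambda>s. \<Sum>w\<in>I. (norm (g w s))\<^sup>2"
  \<comment> \<open>With this integrating factor the energy is nonincreasing.\<close>
  have "exp (- (2 * L) * T) * ?N T \<le> exp (- (2 * L) * 0) * ?N 0"
  proof (rule DERIV_nonpos_imp_decreasing_open[OF T])
    fix s assume s: "0 < s" "s < T"
    have N: "(?N has_real_derivative 2 * Re (\<Sum>w\<in>I. cnj (g w s) * g' w s)) (at s)"
    proof -
      have "((\<lambda>s. g w s \<bullet> g w s) has_vector_derivative g w s \<bullet> g' w s + g' w s \<bullet> g w s) (at s)"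
        if "w \<in> I" for w
        using bounded_bilinear.has_vector_derivative[OF bounded_bilinear_inner deriv deriv] that s
        by blast
      then have "((\<lambda>s. \<Sum>w\<in>I. g w s \<bullet> g w s) has_vector_derivative
          (\<Sum>w\<in>I. g w s \<bullet> g' w s + g' w s \<bullet> g w s)) (at s)"
        by (intro has_vector_derivative_sum) auto
      moreover have "(\<Sum>w\<in>I. g w s \<bullet> g' w s + g' w s \<bullet> g w s) = 2 * Re (\<Sum>w\<in>I. cnj (g w s) * g' w s)"
        by (simp add: inner_complex_def sum_distrib_left algebra_simps)
      ultimately show ?thesis
        by (simp add: has_real_derivative_iff_has_vector_derivative power2_norm_eq_inner)
    qed
    have "((\<lambda>s. exp (- (2 * L) * s) * ?N s) has_real_derivative
        exp (- (2 * L) * s) * (2 * (Re (\<Sum>w\<in>I. cnj (g w s) * g' w s) - L * ?N s))) (at s)"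
      by (rule derivative_eq_intros N refl)+ (simp add: algebra_simps)
    moreover have "exp (- (2 * L) * s) * (2 * (Re (\<Sum>w\<in>I. cnj (g w s) * g' w s) - L * ?N s)) \<le> 0"
      using growth[OF s] by (intro mult_nonneg_nonpos) auto
    ultimately show "\<exists>y. ((\<lambda>s. exp (- (2 * L) * s) * ?N s) has_real_derivative y) (at s) \<and> y \<le> 0"
      by blast
  next
    show "continuous_on {0..T} (\<lambda>s. exp (- (2 * L) * s) * ?N s)"
      by (intro continuous_intros cont)
  qed
  then have "exp (2 * L * T) * (exp (- (2 * L) * T) * ?N T) \<le> exp (2 * L * T) * ?N 0"
    by (intro mult_left_mono) auto
  then have *: "?N T \<le> exp (2 * L * T) * ?N 0"
    by (simp add: mult.assoc[symmetric] flip: exp_add)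
  have "(\<Sum>w\<in>I. norm (g w T))\<^sup>2 \<le> ?N T * card I"
    by (rule sum_squared_le_sum_of_squares)
  also have "\<dots> \<le> exp (2 * L * T) * ?N 0 * (card I)\<^sup>2"
  proof (rule mult_mono[OF *])
    show "real (card I) \<le> (card I)\<^sup>2"
      by (cases "card I") (auto simp: power2_eq_square)
  qed (auto intro!: sum_nonneg mult_nonneg_nonneg)
  also have "\<dots> \<le> exp (2 * L * T) * (\<Sum>w\<in>I. norm (g w 0))\<^sup>2 * (card I)\<^sup>2"
    by (intro mult_right_mono mult_left_mono sum_power2_le_power2_sum I) auto
  also have "\<dots> = (card I * exp (L * T) * (\<Sum>w\<in>I. norm (g w 0)))\<^sup>2"
    by (simp add: power_mult_distrib power2_eq_square flip: exp_add)
  finally show ?thesis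
    by (rule power2_le_imp_le) (intro mult_nonneg_nonneg sum_nonneg; simp)
qed

text \<open>Crude growth bound for systems with bounded coefficients; it serves the short complex
  paths that keep away from all walls.\<close>

lemma linear_system_growth:
  fixes g g' :: "'i \<Rightarrow> real \<Rightarrow> complex" and T K :: real
  assumes I: "finite I" and T: "0 \<le> T"
    and deriv: "\<And>w s. w \<in> I \<Longrightarrow> 0 \<le> s \<Longrightarrow> s \<le> T \<Longrightarrow> (g w has_vector_derivative g' w s) (at s)"
    and bound: "\<And>w s. w \<in> I \<Longrightarrow> 0 \<le> s \<Longrightarrow> s \<le> T \<Longrightarrow> norm (g' w s) \<le> K * (\<Sum>v\<in>I. norm (g v s))"
    and K: "0 \<le> K"
  shows "(\<Sum>w\<in>I. norm (g w T)) \<le> card I * exp (K * card I * T) * (\<Sum>w\<in>I. norm (g w 0))"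
proof (rule energy_growth[OF I T])
  show "continuous_on {0..T} (g w)" if "w \<in> I" for w
    by (rule continuous_on_has_vector_derivative[OF deriv[OF that]]) auto
  fix s assume s: "0 < s" "s < T"
  let ?A = "\<Sum>v\<in>I. norm (g v s)"
  have "Re (\<Sum>w\<in>I. cnj (g w s) * g' w s) \<le> norm (\<Sum>w\<in>I. cnj (g w s) * g' w s)"
    by (rule complex_Re_le_cmod)
  also have "\<dots> \<le> (\<Sum>w\<in>I. norm (g w s) * (K * ?A))"
    using bound s by (intro sum_norm_le) (auto simp: norm_mult intro!: mult_left_mono)
  also have "\<dots> = K * ?A\<^sup>2"
    by (simp add: sum_distrib_right[symmetric] power2_eq_square)
  also have "\<dots> \<le> K * ((\<Sum>v\<in>I. (norm (g v s))\<^sup>2) * card I)"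
    by (intro mult_left_mono K sum_squared_le_sum_of_squares)
  finally show "Re (\<Sum>w\<in>I. cnj (g w s) * g' w s) \<le> K * card I * (\<Sum>v\<in>I. (norm (g v s))\<^sup>2)"
    by (simp add: mult_ac)
qed (use deriv in auto)

section \<open>Oscillating coupling\<close>

text \<open>The coefficients \<open>r \<beta> s\<close> are of size \<open>1 / s\<close> and not
  integrable. Integrating the exponentials by parts trades them for terms of size
  \<open>1 / s\<^sup>2\<close>: one factor \<open>1 / s\<close> from \<open>r\<close>, the other
  from the derivative of \<open>r\<close> or of \<open>p\<close>.\<close>

lemma oscillating_system_bounded_interval:
  fixes I :: "'i set" and B :: "'b set" and \<sigma> :: "'b \<Rightarrow> 'i \<Rightarrow> 'i" and \<kappa> :: "'b \<Rightarrow> complex"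
    and d :: "'b \<Rightarrow> 'i \<Rightarrow> real" and r :: "'b \<Rightarrow> real \<Rightarrow> real" and p :: "'i \<Rightarrow> real \<Rightarrow> complex" and A D :: real
  defines "A \<equiv> \<Sum>\<beta>\<in>B. norm (\<kappa> \<beta>)" and "D \<equiv> \<Sum>w\<in>I. \<Sum>\<beta>\<in>B. norm (\<kappa> \<beta> / (\<i> * d \<beta> w))"
  assumes I: "finite I" and B: "finite B"
    and \<sigma>: "\<And>\<beta> w. \<beta> \<in> B \<Longrightarrow> w \<in> I \<Longrightarrow> \<sigma> \<beta> w \<in> I"
    and d: "\<And>\<beta> w. \<beta> \<in> B \<Longrightarrow> w \<in> I \<Longrightarrow> d \<beta> w \<noteq> 0"
    and S0: "0 < S0" "2 * card I * D * (3 + A) \<le> S0" and S1: "S0 \<le> S1"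
    and r: "\<And>\<beta> s. \<beta> \<in> B \<Longrightarrow> S0 \<le> s \<Longrightarrow> (r \<beta> has_real_derivative - (r \<beta> s)\<^sup>2) (at s)"
      "\<And>\<beta> s. \<beta> \<in> B \<Longrightarrow> S0 \<le> s \<Longrightarrow> 0 \<le> r \<beta> s \<and> r \<beta> s \<le> 1 / s"
    and p: "\<And>w s. w \<in> I \<Longrightarrow> S0 \<le> s \<Longrightarrow>
      (p w has_vector_derivative (\<Sum>\<beta>\<in>B. \<kappa> \<beta> * r \<beta> s * exp (\<i> * d \<beta> w * s) * p (\<sigma> \<beta> w) s)) (at s)"
  shows "(\<Sum>w\<in>I. norm (p w S1)) \<le> 2 * (\<Sum>w\<in>I. norm (p w S0))"
proof -
  define p' where "p' w s = (\<Sum>\<beta>\<in>B. \<kappa> \<beta> * r \<beta> s * exp (\<i> * d \<beta> w * s) * p (\<sigma> \<beta> w) s)" for w s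
  \<comment> \<open>A primitive of the oscillating exponential; this is where the frequencies must
    be nonzero.\<close>
  define E where "E \<beta> w s = exp (\<i> * d \<beta> w * s) / (\<i> * d \<beta> w)" for \<beta> w and s :: real
  \<comment> \<open>The boundary term of the integration by parts is subtracted, so that the terms
    of order \<open>1 / s\<close> cancel in the derivative \<open>q'\<close>.\<close>
  define q where "q w s = p w s - (\<Sum>\<beta>\<in>B. \<kappa> \<beta> * r \<beta> s * E \<beta> w s * p (\<sigma> \<beta> w) s)" for w s
  define q' where "q' w s = (\<Sum>\<beta>\<in>B. \<kappa> \<beta> * E \<beta> w s * ((r \<beta> s)\<^sup>2 * p (\<sigma> \<beta> w) s - r \<beta> s * p' (\<sigma> \<beta> w) s))"
    for w s
  define \<phi> where "\<phi> s = (\<Sum>w\<in>I. norm (p w s))" for s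
  have A0: "A \<ge> 0" and D0: "D \<ge> 0"
    by (auto simp: A_def D_def intro!: sum_nonneg)
  have pd: "(p w has_vector_derivative p' w s) (at s)" if "w \<in> I" "S0 \<le> s" for w s
    using p[OF that] by (simp add: p'_def)
  have normE: "norm (E \<beta> w s) = norm (1 / (\<i> * d \<beta> w))" for \<beta> w s
    by (simp add: E_def norm_divide norm_mult)
  have normkE: "(\<Sum>\<beta>\<in>B. norm (\<kappa> \<beta>) * norm (E \<beta> w s)) \<le> D" if "w \<in> I" for w s
  proof -
    have "(\<Sum>\<beta>\<in>B. norm (\<kappa> \<beta>) * norm (E \<beta> w s)) = (\<Sum>\<beta>\<in>B. norm (\<kappa> \<beta> / (\<i> * d \<beta> w)))"
      by (simp add: normE norm_divide norm_mult)
    also have "\<dots> \<le> D"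
      unfolding D_def using that I by (intro member_le_sum) (auto intro: sum_nonneg)
    finally show ?thesis .
  qed
  have qd: "(q w has_vector_derivative q' w s) (at s)" if w: "w \<in> I" and s: "S0 \<le> s" for w s
  proof -
    have Ed: "(E \<beta> w has_vector_derivative exp (\<i> * d \<beta> w * s)) (at s)" if "\<beta> \<in> B" for \<beta>
    proof -
      have "((\<lambda>z. exp (\<i> * d \<beta> w * z) / (\<i> * d \<beta> w)) has_field_derivative
          exp (\<i> * d \<beta> w * of_real s)) (at (of_real s))"
        using d[OF that w] by (auto intro!: derivative_eq_intros)
      then show ?thesis
        using has_vector_derivative_real_field unfolding E_def by blast
    qed
    have rd: "((\<lambda>s. complex_of_real (r \<beta> s)) has_vector_derivative - (complex_of_real (r \<beta> s))\<^sup>2) (at s)"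
      if "\<beta> \<in> B" for \<beta>
      using has_vector_derivative_of_real[OF r(1)[OF that s]] by simp
    have "((\<lambda>s. \<kappa> \<beta> * r \<beta> s * E \<beta> w s * p (\<sigma> \<beta> w) s) has_vector_derivative
        \<kappa> \<beta> * r \<beta> s * exp (\<i> * d \<beta> w * s) * p (\<sigma> \<beta> w) s
        - \<kappa> \<beta> * E \<beta> w s * ((r \<beta> s)\<^sup>2 * p (\<sigma> \<beta> w) s - r \<beta> s * p' (\<sigma> \<beta> w) s)) (at s)"
      if \<beta>: "\<beta> \<in> B" for \<beta>
    proof -
      have "((\<lambda>s. \<kappa> \<beta> * r \<beta> s) has_vector_derivative - \<kappa> \<beta> * (complex_of_real (r \<beta> s))\<^sup>2) (at s)"
        using has_vector_derivative_mult_right[OF rd[OF \<beta>], of "\<kappa> \<beta>"] by simp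
      from has_vector_derivative_mult[OF has_vector_derivative_mult[OF this Ed[OF \<beta>]] pd[OF \<sigma>[OF \<beta> w] s]]
      show ?thesis by (simp add: algebra_simps)
    qed
    from has_vector_derivative_diff[OF pd[OF w s] has_vector_derivative_sum[OF this]]
    have "(q w has_vector_derivative p' w s - (\<Sum>\<beta>\<in>B. \<kappa> \<beta> * r \<beta> s * exp (\<i> * d \<beta> w * s) * p (\<sigma> \<beta> w) s
        - \<kappa> \<beta> * E \<beta> w s * ((r \<beta> s)\<^sup>2 * p (\<sigma> \<beta> w) s - r \<beta> s * p' (\<sigma> \<beta> w) s))) (at s)"
      unfolding q_def by simp
    then show ?thesis
      by (simp add: p'_def[of w] q'_def sum_subtractf)
  qed
  \<comment> \<open>Bootstrap: \<open>M\<close> is the largest total size on the interval, attained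
    at \<open>s\<close>. Everything up to time \<open>s\<close> is estimated by \<open>M\<close>,
    and the resulting inequality for \<open>M\<close> itself is then solved.\<close>
  have "continuous_on {S0..S1} \<phi>"
    unfolding \<phi>_def
    by (intro continuous_intros continuous_on_has_vector_derivative[OF pd]) auto
  then obtain s where s: "s \<in> {S0..S1}" and max: "\<And>t. t \<in> {S0..S1} \<Longrightarrow> \<phi> t \<le> \<phi> s"
    using continuous_attains_sup[of "{S0..S1}" \<phi>] S1 by auto
  define M where "M = \<phi> s"
  have pM: "norm (p w t) \<le> M" if "w \<in> I" "S0 \<le> t" "t \<le> s" for w t
  proof -
    have "norm (p w t) \<le> \<phi> t"
      unfolding \<phi>_def using that I by (intro member_le_sum) auto
    also have "\<dots> \<le> M" unfolding M_def using that s by (intro max) auto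
    finally show ?thesis .
  qed
  have M0: "M \<ge> 0" by (auto simp: M_def \<phi>_def intro: sum_nonneg)
  have p'M: "norm (p' w t) \<le> A * M / t" if "w \<in> I" "S0 \<le> t" "t \<le> s" for w t
  proof -
    have "norm (p' w t) \<le> (\<Sum>\<beta>\<in>B. norm (\<kappa> \<beta>) * (1 / t) * M)"
      unfolding p'_def
    proof (rule sum_norm_le)
      fix \<beta> assume \<beta>: "\<beta> \<in> B"
      have "norm (\<kappa> \<beta> * complex_of_real (r \<beta> t) * exp (\<i> * d \<beta> w * t) * p (\<sigma> \<beta> w) t)
        = norm (\<kappa> \<beta>) * r \<beta> t * norm (p (\<sigma> \<beta> w) t)"
        using r(2)[OF \<beta> that(2)] by (simp add: norm_mult)
      also have "\<dots> \<le> norm (\<kappa> \<beta>) * (1 / t) * M"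
        using r(2)[OF \<beta> that(2)] that \<sigma>[OF \<beta> that(1)] S0(1)
        by (intro mult_mono pM mult_left_mono mult_nonneg_nonneg) auto
      finally show "norm (\<kappa> \<beta> * complex_of_real (r \<beta> t) * exp (\<i> * d \<beta> w * t) * p (\<sigma> \<beta> w) t)
        \<le> norm (\<kappa> \<beta>) * (1 / t) * M" .
    qed
    then show ?thesis by (simp add: A_def sum_distrib_right sum_divide_distrib)
  qed
  have q'M: "norm (q' w t) \<le> D * M * (1 + A) / t\<^sup>2" if w: "w \<in> I" and t: "S0 \<le> t" "t \<le> s" for w t
  proof -
    have "norm (q' w t) \<le> (\<Sum>\<beta>\<in>B. norm (\<kappa> \<beta>) * norm (E \<beta> w t) * ((1 / t)\<^sup>2 * M + 1 / t * (A * M / t)))"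
      unfolding q'_def
    proof (rule sum_norm_le)
      fix \<beta> assume \<beta>: "\<beta> \<in> B"
      have "norm (complex_of_real ((r \<beta> t)\<^sup>2) * p (\<sigma> \<beta> w) t - r \<beta> t * p' (\<sigma> \<beta> w) t)
        \<le> (r \<beta> t)\<^sup>2 * norm (p (\<sigma> \<beta> w) t) + r \<beta> t * norm (p' (\<sigma> \<beta> w) t)"
        using r(2)[OF \<beta> t(1)]
        by (intro order_trans[OF norm_triangle_ineq4]) (simp add: norm_mult norm_power)
      also have "\<dots> \<le> (1 / t)\<^sup>2 * M + 1 / t * (A * M / t)"
        using r(2)[OF \<beta> t(1)] t S0 \<sigma>[OF \<beta> w]
        by (intro add_mono mult_mono power_mono pM p'M) auto
      finally show "norm (\<kappa> \<beta> * E \<beta> w t * (complex_of_real ((r \<beta> t)\<^sup>2) * p (\<sigma> \<beta> w) t - r \<beta> t * p' (\<sigma> \<beta> w) t))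
        \<le> norm (\<kappa> \<beta>) * norm (E \<beta> w t) * ((1 / t)\<^sup>2 * M + 1 / t * (A * M / t))"
        by (simp add: norm_mult mult_left_mono)
    qed
    also have "\<dots> = (\<Sum>\<beta>\<in>B. norm (\<kappa> \<beta>) * norm (E \<beta> w t)) * (M * (1 + A) / t\<^sup>2)"
      unfolding sum_distrib_right
      by (intro sum.cong) (simp_all add: algebra_simps power2_eq_square add_divide_distrib)
    also have "\<dots> \<le> D * (M * (1 + A) / t\<^sup>2)"
      using M0 A0 by (intro mult_right_mono normkE w) auto
    finally show ?thesis by simp
  qed
  have qp: "norm (p w t - q w t) \<le> D * M / t" if w: "w \<in> I" and t: "S0 \<le> t" "t \<le> s" for w t
  proof -
    have "norm (p w t - q w t) \<le> (\<Sum>\<beta>\<in>B. norm (\<kappa> \<beta>) * norm (E \<beta> w t) * (1 / t * M))"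
      unfolding q_def
    proof (simp, rule sum_norm_le)
      fix \<beta> assume \<beta>: "\<beta> \<in> B"
      have "r \<beta> t * norm (p (\<sigma> \<beta> w) t) \<le> 1 / t * M"
        using r(2)[OF \<beta> t(1)] t S0 \<sigma>[OF \<beta> w] by (intro mult_mono pM) auto
      then have "norm (\<kappa> \<beta>) * norm (E \<beta> w t) * (r \<beta> t * norm (p (\<sigma> \<beta> w) t))
        \<le> norm (\<kappa> \<beta>) * norm (E \<beta> w t) * (1 / t * M)"
        by (intro mult_left_mono) auto
      then show "norm (\<kappa> \<beta> * complex_of_real (r \<beta> t) * E \<beta> w t * p (\<sigma> \<beta> w) t)
        \<le> norm (\<kappa> \<beta>) * norm (E \<beta> w t) * M / t"
        using r(2)[OF \<beta> t(1)] by (simp add: norm_mult mult_ac)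
    qed
    also have "\<dots> = (\<Sum>\<beta>\<in>B. norm (\<kappa> \<beta>) * norm (E \<beta> w t)) * (M / t)"
      by (simp add: sum_distrib_right sum_divide_distrib)
    also have "\<dots> \<le> D * (M / t)"
      using M0 t S0 by (intro mult_right_mono normkE w) auto
    finally show ?thesis by simp
  qed
  \<comment> \<open>The constant \<open>3 + A\<close> collects \<open>1 + A\<close> from integrating
    the bound on \<open>q'\<close> and 1 for each of the two differences between \<open>p\<close>
    and \<open>q\<close>, at \<open>s\<close> and at \<open>S0\<close>.\<close>
  have step: "norm (p w s) \<le> norm (p w S0) + D * M * (3 + A) / S0" if w: "w \<in> I" for w
  proof -
    have "norm (q w s - q w S0) \<le> D * M * (1 + A) / S0"
    proof (cases "S0 < s")
      case True
      have "norm (q w s - q w S0) \<le> - (D * M * (1 + A)) / s - - (D * M * (1 + A)) / S0"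
      proof (rule differentiable_bound_general[OF True])
        show "continuous_on {S0..s} (q w)"
          by (rule continuous_on_has_vector_derivative[OF qd[OF w]]) auto
        show "continuous_on {S0..s} (\<lambda>s. - (D * M * (1 + A)) / s)"
          using S0 by (intro continuous_intros) auto
        fix t assume t: "S0 < t" "t < s"
        show "(q w has_vector_derivative q' w t) (at t)"
          using qd w t by auto
        show "((\<lambda>s. - (D * M * (1 + A)) / s) has_vector_derivative D * M * (1 + A) / t\<^sup>2) (at t)"
          using t S0 unfolding has_real_derivative_iff_has_vector_derivative[symmetric]
          by (auto intro!: derivative_eq_intros simp: power2_eq_square)
        show "norm (q' w t) \<le> D * M * (1 + A) / t\<^sup>2"
          using q'M w t by auto
      qed
      also have "\<dots> \<le> D * M * (1 + A) / S0"
        using True S0 D0 M0 A0 by simp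
      finally show ?thesis .
    qed (use s D0 M0 A0 S0 in auto)
    moreover have "norm (p w S0 - q w S0) \<le> D * M / S0"
      using qp[OF w, of S0] s by auto
    moreover have "D * M / s \<le> D * M / S0"
      using s S0(1) D0 M0 by (intro divide_left_mono mult_nonneg_nonneg mult_pos_pos) auto
    then have "norm (p w s - q w s) \<le> D * M / S0"
      using qp[OF w, of s] s by auto
    moreover have "p w s = p w S0 + ((q w s - q w S0) + ((p w s - q w s) - (p w S0 - q w S0)))"
      by simp
    then have "norm (p w s) \<le> norm (p w S0) + (norm (q w s - q w S0) + (norm (p w s - q w s) + norm (p w S0 - q w S0)))"
      by (metis norm_triangle_ineq norm_triangle_ineq4 norm_triangle_mono order_refl)
    ultimately have "norm (p w s) \<le> norm (p w S0) + (D * M * (1 + A) / S0 + (D * M / S0 + D * M / S0))"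
      by linarith
    then show ?thesis by (simp add: algebra_simps add_divide_distrib)
  qed
  \<comment> \<open>Summation over \<open>I\<close> gives an error of at most \<open>M / 2\<close>
    by the choice of \<open>S0\<close>, and this is absorbed on the left.\<close>
  have "M \<le> (\<Sum>w\<in>I. norm (p w S0) + D * M * (3 + A) / S0)"
    unfolding M_def \<phi>_def by (rule sum_mono) (use step in \<open>simp add: M_def \<phi>_def\<close>)
  also have "\<dots> = \<phi> S0 + (2 * card I * D * (3 + A) / S0) * (M / 2)"
    by (simp add: \<phi>_def sum.distrib)
  also have "\<dots> \<le> \<phi> S0 + 1 * (M / 2)"
    using S0 M0 by (intro add_left_mono mult_right_mono) auto
  finally have "M \<le> 2 * \<phi> S0" by simp
  moreover have "\<phi> S1 \<le> M" unfolding M_def using S1 by (intro max) auto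
  ultimately show ?thesis by (simp add: \<phi>_def)
qed

text \<open>The quantifier order carries the content: \<open>S0\<close> is built from
  \<open>\<kappa>\<close>, \<open>\<theta>\<close> and \<sigma> alone, hence serves all offsets
  \<tau> and all solutions. Removing the diagonal terms reduces the claim to the purely oscillating
  system.\<close>

lemma oscillating_system_bound:
  fixes I :: "'i set" and B :: "'b set" and \<sigma> :: "'b \<Rightarrow> 'i \<Rightarrow> 'i" and \<kappa> :: "'b \<Rightarrow> complex"
    and b :: "'b \<Rightarrow> real" and \<theta> :: "'i \<Rightarrow> real"
  assumes I: "finite I" and B: "finite B"
    and \<sigma>: "\<And>\<beta> w. \<beta> \<in> B \<Longrightarrow> w \<in> I \<Longrightarrow> \<sigma> \<beta> w \<in> I"
    and \<theta>: "\<And>\<beta> w. \<beta> \<in> B \<Longrightarrow> w \<in> I \<Longrightarrow> \<theta> (\<sigma> \<beta> w) \<noteq> \<theta> w"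
    and b: "\<And>\<beta>. \<beta> \<in> B \<Longrightarrow> 0 < b \<beta>"
  shows "\<exists>S0>0. \<forall>\<tau> g s. (\<forall>\<beta>\<in>B. 0 \<le> \<tau> \<beta>) \<longrightarrow>
     (\<forall>w\<in>I. \<forall>s\<ge>S0. (g w has_vector_derivative
       \<i> * \<theta> w * g w s - (\<Sum>\<beta>\<in>B. \<kappa> \<beta> * of_real (b \<beta> / (\<tau> \<beta> + b \<beta> * s)) * (g w s - g (\<sigma> \<beta> w) s))) (at s)) \<longrightarrow>
     S0 \<le> s \<longrightarrow>
     (\<Sum>w\<in>I. norm (g w s)) * exp (\<Sum>\<beta>\<in>B. Re (\<kappa> \<beta>) * ln (\<tau> \<beta> + b \<beta> * s))
     \<le> 2 * ((\<Sum>w\<in>I. norm (g w S0)) * exp (\<Sum>\<beta>\<in>B. Re (\<kappa> \<beta>) * ln (\<tau> \<beta> + b \<beta> * S0)))"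
proof -
  define d where "d \<beta> w = \<theta> (\<sigma> \<beta> w) - \<theta> w" for \<beta> w
  define A where "A = (\<Sum>\<beta>\<in>B. norm (\<kappa> \<beta>))"
  define D where "D = (\<Sum>w\<in>I. \<Sum>\<beta>\<in>B. norm (\<kappa> \<beta> / (\<i> * d \<beta> w)))"
  \<comment> \<open>The summand 1 keeps \<open>S0\<close> positive if \<open>D = 0\<close>.\<close>
  define S0 where "S0 = 1 + 2 * card I * D * (3 + A)"
  have "A \<ge> 0" "D \<ge> 0"
    by (auto simp: A_def D_def intro!: sum_nonneg)
  then have S0: "0 < S0" "2 * card I * D * (3 + A) \<le> S0"
    by (auto simp: S0_def intro!: add_pos_nonneg)
  show ?thesis
  proof (intro exI[of _ S0] conjI allI impI)
    show "0 < S0" by (rule S0(1))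
    fix \<tau> :: "'b \<Rightarrow> real" and g :: "'i \<Rightarrow> real \<Rightarrow> complex" and S1
    assume "\<forall>\<beta>\<in>B. 0 \<le> \<tau> \<beta>" and S1: "S0 \<le> S1"
      and "\<forall>w\<in>I. \<forall>s\<ge>S0. (g w has_vector_derivative
         \<i> * \<theta> w * g w s - (\<Sum>\<beta>\<in>B. \<kappa> \<beta> * of_real (b \<beta> / (\<tau> \<beta> + b \<beta> * s)) * (g w s - g (\<sigma> \<beta> w) s))) (at s)"
    then have \<tau>: "\<And>\<beta>. \<beta> \<in> B \<Longrightarrow> 0 \<le> \<tau> \<beta>"
      and g: "\<And>w s. w \<in> I \<Longrightarrow> S0 \<le> s \<Longrightarrow> (g w has_vector_derivative
         \<i> * \<theta> w * g w s - (\<Sum>\<beta>\<in>B. \<kappa> \<beta> * of_real (b \<beta> / (\<tau> \<beta> + b \<beta> * s)) * (g w s - g (\<sigma> \<beta> w) s))) (at s)"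
      by blast+
    define r where "r \<beta> s = b \<beta> / (\<tau> \<beta> + b \<beta> * s)" for \<beta> s
    \<comment> \<open>Integrating factor of the diagonal part. Its exponent has the primitives of
      \<open>b \<beta> / (\<tau> \<beta> + b \<beta> * s)\<close>; since \<theta> is real, its
      modulus is exactly the weight in the claim.\<close>
    define m where "m w s = exp (- \<i> * \<theta> w * s + (\<Sum>\<beta>\<in>B. \<kappa> \<beta> * of_real (ln (\<tau> \<beta> + b \<beta> * s))))" for w s
    define p where "p w s = m w s * g w s" for w s
    have pos: "0 < \<tau> \<beta> + b \<beta> * s" if "\<beta> \<in> B" "S0 \<le> s" for \<beta> s
      using \<tau>[OF that(1)] b[OF that(1)] S0(1) that(2) by (simp add: add_nonneg_pos)
    have np: "norm (p w s) = norm (g w s) * exp (\<Sum>\<beta>\<in>B. Re (\<kappa> \<beta>) * ln (\<tau> \<beta> + b \<beta> * s))" for w s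
      by (simp add: p_def m_def norm_mult)
    have r': "(r \<beta> has_real_derivative - (r \<beta> s)\<^sup>2) (at s)" if "\<beta> \<in> B" "S0 \<le> s" for \<beta> s
      unfolding r_def using pos[OF that]
      by (auto intro!: derivative_eq_intros simp: power2_eq_square divide_simps)
    have r01: "0 \<le> r \<beta> s \<and> r \<beta> s \<le> 1 / s" if "\<beta> \<in> B" "S0 \<le> s" for \<beta> s
      using pos[OF that] b[OF that(1)] S0(1) that(2) \<tau>[OF that(1)]
      by (auto simp: r_def divide_simps)
    have p': "(p w has_vector_derivative
        (\<Sum>\<beta>\<in>B. \<kappa> \<beta> * r \<beta> s * exp (\<i> * d \<beta> w * s) * p (\<sigma> \<beta> w) s)) (at s)" if w: "w \<in> I" and s: "S0 \<le> s" for w s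
    proof -
      have ln': "((\<lambda>s. complex_of_real (ln (\<tau> \<beta> + b \<beta> * s))) has_vector_derivative of_real (r \<beta> s)) (at s)"
        if "\<beta> \<in> B" for \<beta>
        by (rule has_vector_derivative_of_real)
           (use pos[OF that s] in \<open>auto intro!: derivative_eq_intros simp: r_def\<close>)
      have "((\<lambda>s. - \<i> * \<theta> w * of_real s) has_vector_derivative - \<i> * \<theta> w) (at s)"
        by (auto intro!: derivative_eq_intros)
      then have "((\<lambda>s. - \<i> * \<theta> w * s + (\<Sum>\<beta>\<in>B. \<kappa> \<beta> * of_real (ln (\<tau> \<beta> + b \<beta> * s)))) has_vector_derivative
          - \<i> * \<theta> w + (\<Sum>\<beta>\<in>B. \<kappa> \<beta> * of_real (r \<beta> s))) (at s)"
        by (intro has_vector_derivative_add has_vector_derivative_sum has_vector_derivative_mult_right ln')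
      from field_vector_diff_chain_at[OF this DERIV_exp]
      have "(m w has_vector_derivative (- \<i> * \<theta> w + (\<Sum>\<beta>\<in>B. \<kappa> \<beta> * of_real (r \<beta> s))) * m w s) (at s)"
        unfolding m_def[abs_def] by (simp add: o_def)
      from has_vector_derivative_mult[OF this g[OF w s]]
      have "(p w has_vector_derivative m w s *
         (\<i> * \<theta> w * g w s - (\<Sum>\<beta>\<in>B. \<kappa> \<beta> * of_real (r \<beta> s) * (g w s - g (\<sigma> \<beta> w) s)))
         + (- \<i> * \<theta> w + (\<Sum>\<beta>\<in>B. \<kappa> \<beta> * of_real (r \<beta> s))) * m w s * g w s) (at s)"
        unfolding p_def r_def by simp
      also have "m w s * (\<i> * \<theta> w * g w s - (\<Sum>\<beta>\<in>B. \<kappa> \<beta> * of_real (r \<beta> s) * (g w s - g (\<sigma> \<beta> w) s)))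
         + (- \<i> * \<theta> w + (\<Sum>\<beta>\<in>B. \<kappa> \<beta> * of_real (r \<beta> s))) * m w s * g w s
        = (\<Sum>\<beta>\<in>B. \<kappa> \<beta> * r \<beta> s * (m w s * g (\<sigma> \<beta> w) s))"
        by (simp add: algebra_simps sum_subtractf sum_distrib_left sum_distrib_right)
      also have "\<dots> = (\<Sum>\<beta>\<in>B. \<kappa> \<beta> * r \<beta> s * exp (\<i> * d \<beta> w * s) * p (\<sigma> \<beta> w) s)"
      proof (rule sum.cong[OF refl])
        fix \<beta>
        \<comment> \<open>Only the phase of \<open>m\<close> depends on \<open>w\<close>, so passing
          to the coupled index leaves a pure oscillation of frequency
          \<open>d \<beta> w\<close>.\<close>
        have "m w s = exp (\<i> * d \<beta> w * s) * m (\<sigma> \<beta> w) s"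
          by (simp add: m_def d_def flip: exp_add) (simp add: algebra_simps)
        then show "\<kappa> \<beta> * r \<beta> s * (m w s * g (\<sigma> \<beta> w) s) = \<kappa> \<beta> * r \<beta> s * exp (\<i> * d \<beta> w * s) * p (\<sigma> \<beta> w) s"
          by (simp add: p_def)
      qed
      finally show ?thesis .
    qed
    have "(\<Sum>w\<in>I. norm (p w S1)) \<le> 2 * (\<Sum>w\<in>I. norm (p w S0))"
      by (rule oscillating_system_bounded_interval[where \<sigma> = \<sigma> and \<kappa> = \<kappa> and d = d and r = r and B = B])
         (use I B \<sigma> \<theta> S0 S1 r' r01 p' in \<open>auto simp: d_def A_def D_def\<close>)
    then show "(\<Sum>w\<in>I. norm (g w S1)) * exp (\<Sum>\<beta>\<in>B. Re (\<kappa> \<beta>) * ln (\<tau> \<beta> + b \<beta> * S1))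
     \<le> 2 * ((\<Sum>w\<in>I. norm (g w S0)) * exp (\<Sum>\<beta>\<in>B. Re (\<kappa> \<beta>) * ln (\<tau> \<beta> + b \<beta> * S0)))"
      by (simp add: np sum_distrib_right)
  qed
qed

section \<open>The reflection group\<close>

abbreviation (input) cmap :: "('a \<Rightarrow> 'a) \<Rightarrow> 'a complexification \<Rightarrow> 'a complexification" where
  "cmap w \<equiv> map_prod w w"

lemma orthogonal_transformation_root_refl:
  "\<alpha> \<bullet> \<alpha> = 2 \<Longrightarrow> orthogonal_transformation (root_refl \<alpha>)"
  unfolding orthogonal_transformation_def
  by (auto intro!: linearI simp: root_refl_def inner_simps algebra_simps inner_commute)

lemma root_refl_orthogonal_transformation:
  "orthogonal_transformation w \<Longrightarrow> root_refl (w \<beta>) (w x) = w (root_refl \<beta> x)"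
  by (auto simp: root_refl_def orthogonal_transformation_def linear_diff linear_scale)

lemma root_crefl_eq: "root_crefl \<alpha> z = cmap (root_refl \<alpha>) z"
  by (simp add: root_crefl_def root_refl_def prod_eq_iff cscale_cplx_of Re_cform_cplx_of Im_cform_cplx_of)

lemma cform_cmap:
  "orthogonal_transformation w \<Longrightarrow> cform (cplx_of (w \<beta>)) (cmap w z) = cform (cplx_of \<beta>) z"
  by (simp add: complex_eq_iff Re_cform_cplx_of Im_cform_cplx_of orthogonal_transformation_def)

lemma cmap_cplx_of: "orthogonal_transformation w \<Longrightarrow> cmap w (cplx_of x) = cplx_of (w x)"
  by (simp add: cplx_of_def orthogonal_transformation_linear linear_0)

lemma bounded_linear_cmap:
  fixes w :: "'a::euclidean_space \<Rightarrow> 'a"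
  shows "orthogonal_transformation w \<Longrightarrow> bounded_linear (cmap w)"
  by (rule linear_conv_bounded_linear[THEN iffD1], rule linearI)
     (auto dest: orthogonal_transformation_linear simp: linear_add linear_scale)

lemma cmap_cmap: "cmap v (cmap w z) = cmap (v \<circ> w) z"
  by (simp add: prod_eq_iff)

text \<open>From \<open>1 + \<bar>a\<bar> \<le> (1 + \<bar>b\<bar>) * (1 + \<bar>a -
  b\<bar>)\<close>: bounded displacements change the weight by bounded factors only.\<close>

lemma ln_one_plus_abs_le:
  fixes a b :: real
  shows "ln (1 + \<bar>a\<bar>) \<le> ln (1 + \<bar>b\<bar>) + \<bar>a - b\<bar>"
proof -
  have "ln (1 + \<bar>a\<bar>) \<le> ln ((1 + \<bar>b\<bar>) * (1 + \<bar>a - b\<bar>))"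
    by (subst ln_le_cancel_iff) (auto simp: algebra_simps intro!: add_pos_nonneg, smt (verit) mult_nonneg_nonneg)
  also have "\<dots> = ln (1 + \<bar>b\<bar>) + ln (1 + \<bar>a - b\<bar>)"
    by (rule ln_mult_pos) (auto intro: add_pos_nonneg)
  also have "\<dots> \<le> ln (1 + \<bar>b\<bar>) + \<bar>a - b\<bar>"
    by (simp add: ln_add_one_self_le_self)
  finally show ?thesis .
qed

text \<open>The oscillation estimate produces factors \<open>t\<close>, the weight has
  \<open>1 + t\<close>; away from 0 their ratio is bounded.\<close>

lemma ln_one_plus_le:
  fixes a t :: real
  assumes "0 < a" "a \<le> t"
  shows "ln (1 + t) \<le> ln t + ln (1 + 1 / a)"
proof -
  have "1 + t \<le> t * (1 + 1 / a)"
    using assms by (simp add: field_simps)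
  then have "ln (1 + t) \<le> ln (t * (1 + 1 / a))"
    using assms by (intro ln_mono) auto
  also have "\<dots> = ln t + ln (1 + 1 / a)"
    using assms by (intro ln_mult_pos) (auto intro: add_pos_pos)
  finally show ?thesis .
qed

locale positive_root_system =
  fixes R Rpos :: "'a::euclidean_space set" and k :: "'a \<Rightarrow> complex"
  assumes root_system: "normalized_root_system R"
    and positive: "positive_roots R Rpos"
    and multiplicity: "multiplicity_function R k"
    and Re_k: "\<forall>\<alpha>\<in>R. Re (k \<alpha>) \<ge> 0"
begin

abbreviation W :: "('a \<Rightarrow> 'a) set" where
  "W \<equiv> reflection_group R"

definition chamber :: "'a set" where
  "chamber = {x. \<forall>\<alpha>\<in>Rpos. 0 \<le> \<alpha> \<bullet> x}"

text \<open>The logarithm of the modulus of \<Omega>^(1/2); additive form suits the comparison of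
  weights at different points.\<close>

definition log_weight :: "'a \<Rightarrow> real" where
  "log_weight x = (\<Sum>\<alpha>\<in>Rpos. Re (k \<alpha>) * ln (1 + \<bar>\<alpha> \<bullet> x\<bar>))"

section \<open>Roots, signs and sums over the reflection group\<close>

lemma finite_R: "finite R" and span_R: "span R = UNIV"
  and inner_root_self: "\<alpha> \<in> R \<Longrightarrow> \<alpha> \<bullet> \<alpha> = 2"
  and root_refl_image: "\<alpha> \<in> R \<Longrightarrow> root_refl \<alpha> ` R = R"
  using root_system by (auto simp: normalized_root_system_def)

lemma uminus_root: "\<alpha> \<in> R \<Longrightarrow> - \<alpha> \<in> R"
  using root_system by (auto simp: normalized_root_system_def)

lemma root_refl_self: "\<alpha> \<in> R \<Longrightarrow> root_refl \<alpha> \<alpha> = - \<alpha>"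
  using inner_root_self[of \<alpha>] by (simp add: root_refl_def scaleR_2)

lemma root_refl_involution: "\<alpha> \<in> R \<Longrightarrow> root_refl \<alpha> \<circ> root_refl \<alpha> = id"
  using inner_root_self[of \<alpha>] by (auto simp: root_refl_def fun_eq_iff inner_simps algebra_simps)

lemma Rpos_subset: "\<alpha> \<in> Rpos \<Longrightarrow> \<alpha> \<in> R"
  using positive by (auto simp: positive_roots_def)

lemma finite_Rpos: "finite Rpos"
  by (rule finite_subset[OF _ finite_R]) (auto dest: Rpos_subset)

lemma Rpos_or: "\<alpha> \<in> R \<Longrightarrow> \<alpha> \<in> Rpos \<or> - \<alpha> \<in> Rpos"
  and Rpos_not_both: "\<alpha> \<in> Rpos \<Longrightarrow> - \<alpha> \<notin> Rpos"
  using positive by (auto simp: positive_roots_def regular_def uminus_root; force)+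

lemma W_orthogonal: "w \<in> W \<Longrightarrow> orthogonal_transformation w"
proof (induction rule: reflection_group.induct)
  case id
  show ?case by (simp add: orthogonal_transformation_def linear_id)
next
  case (comp \<alpha> w)
  then show ?case
    by (metis orthogonal_transformation_compose orthogonal_transformation_root_refl inner_root_self)
qed

lemma W_image: "w \<in> W \<Longrightarrow> w ` R = R"
proof (induction rule: reflection_group.induct)
  case (comp \<alpha> w)
  then show ?case by (metis image_comp root_refl_image)
qed simp

lemma W_root: "w \<in> W \<Longrightarrow> \<alpha> \<in> R \<Longrightarrow> w \<alpha> \<in> R"
  using W_image by blast

lemma root_refl_W: "\<alpha> \<in> R \<Longrightarrow> root_refl \<alpha> \<in> W"
  using reflection_group.comp[OF _ reflection_group.id, of \<alpha>] by simp

lemma W_compose: "v \<in> W \<Longrightarrow> w \<in> W \<Longrightarrow> v \<circ> w \<in> W"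
proof (induction rule: reflection_group.induct)
  case (comp \<alpha> v)
  then show ?case unfolding comp_assoc by (blast intro: reflection_group.comp)
qed simp

text \<open>An element of \<open>W\<close> is linear, hence determined by its action on the finite
  spanning set \<open>R\<close>, which it maps to itself.\<close>

lemma finite_W: "finite W"
proof (rule inj_on_finite)
  show "inj_on (\<lambda>w. restrict w R) W"
  proof (rule inj_onI)
    fix v w assume vw: "v \<in> W" "w \<in> W" and eq: "restrict v R = restrict w R"
    have "v x = w x" for x
    proof (rule linear_eq_on_span[of v w R])
      show "v y = w y" if "y \<in> R" for y
        using fun_cong[OF eq, of y] that by simp
    qed (use vw W_orthogonal orthogonal_transformation_linear span_R in auto)
    then show "v = w" ..
  qed
  show "(\<lambda>w. restrict w R) ` W \<subseteq> R \<rightarrow>\<^sub>E R"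
    using W_root by auto
  show "finite (R \<rightarrow>\<^sub>E R)"
    using finite_R by (intro finite_PiE) auto
qed

text \<open>Right composition with \<open>v\<close> is injective because \<open>v\<close> is
  surjective; finiteness of \<open>W\<close> makes it a bijection without producing
  inverses.\<close>

lemma sum_W_compose:
  assumes v: "v \<in> W"
  shows "(\<Sum>w\<in>W. h (w \<circ> v)) = (\<Sum>w\<in>W. h w)"
proof -
  have inj: "inj_on (\<lambda>w. w \<circ> v) W"
    using orthogonal_transformation_surj[OF W_orthogonal[OF v]]
    by (auto intro!: inj_onI simp: fun_eq_iff) (metis surjD)
  then have "(\<lambda>w. w \<circ> v) ` W = W"
    using W_compose v by (intro endo_inj_surj finite_W) auto
  then show ?thesis
    using sum.reindex[OF inj, of h] by simp
qed

lemma k_W: "w \<in> W \<Longrightarrow> \<alpha> \<in> R \<Longrightarrow> k (w \<alpha>) = k \<alpha>"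
  using multiplicity by (simp add: multiplicity_function_def)

lemma k_uminus: "\<alpha> \<in> R \<Longrightarrow> k (- \<alpha>) = k \<alpha>"
  using k_W[OF root_refl_W] root_refl_self by metis

lemma Re_k_nonneg: "\<alpha> \<in> Rpos \<Longrightarrow> 0 \<le> Re (k \<alpha>)"
  using Re_k Rpos_subset by blast

lemma sum_roots_eq:
  fixes h :: "'a \<Rightarrow> 'b::real_vector"
  assumes even: "\<And>\<alpha>. \<alpha> \<in> R \<Longrightarrow> h (- \<alpha>) = h \<alpha>"
  shows "(\<Sum>\<alpha>\<in>R. h \<alpha>) = 2 *\<^sub>R (\<Sum>\<alpha>\<in>Rpos. h \<alpha>)"
proof -
  have R: "R = Rpos \<union> uminus ` Rpos"
    using Rpos_or Rpos_subset uminus_root by (force simp: image_iff)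
  have "(\<Sum>\<alpha>\<in>R. h \<alpha>) = (\<Sum>\<alpha>\<in>Rpos. h \<alpha>) + (\<Sum>\<alpha>\<in>uminus ` Rpos. h \<alpha>)"
    by (subst R, rule sum.union_disjoint) (use finite_Rpos Rpos_not_both in auto)
  also have "(\<Sum>\<alpha>\<in>uminus ` Rpos. h \<alpha>) = (\<Sum>\<alpha>\<in>Rpos. h \<alpha>)"
    by (subst sum.reindex) (auto simp: even Rpos_subset)
  finally show ?thesis by (simp add: scaleR_2)
qed

text \<open>\<open>w\<close> need not preserve \<open>Rpos\<close>, but it permutes
  \<open>R\<close>, and for even summands the sum over \<open>Rpos\<close> is half the sum over
  \<open>R\<close>.\<close>

lemma sum_Rpos_W:
  fixes h :: "'a \<Rightarrow> 'b::real_vector"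
  assumes w: "w \<in> W" and even: "\<And>\<alpha>. \<alpha> \<in> R \<Longrightarrow> h (- \<alpha>) = h \<alpha>"
  shows "(\<Sum>\<alpha>\<in>Rpos. h (w \<alpha>)) = (\<Sum>\<alpha>\<in>Rpos. h \<alpha>)"
proof -
  have "(\<Sum>\<alpha>\<in>R. h \<alpha>) = (\<Sum>\<alpha>\<in>R. h (w \<alpha>))"
    using sum.reindex[of w R h] W_image[OF w] orthogonal_transformation_inj[OF W_orthogonal[OF w]]
    by (simp add: inj_on_subset)
  moreover have "h (w (- \<alpha>)) = h (w \<alpha>)" if "\<alpha> \<in> R" for \<alpha>
    using even[OF W_root[OF w that]] orthogonal_transformation_linear[OF W_orthogonal[OF w]]
    by (simp add: linear_neg)
  ultimately show ?thesis
    using sum_roots_eq[of h] sum_roots_eq[of "\<lambda>\<alpha>. h (w \<alpha>)"] even by simp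
qed

section \<open>Invariance and variation of the weight\<close>

lemma log_weight_W:
  assumes w: "w \<in> W"
  shows "log_weight (w x) = log_weight x"
proof -
  have "log_weight (w x) = (\<Sum>\<alpha>\<in>Rpos. Re (k (w \<alpha>)) * ln (1 + \<bar>w \<alpha> \<bullet> w x\<bar>))"
    unfolding log_weight_def
    by (rule sum_Rpos_W[OF w, symmetric]) (simp add: k_uminus)
  also have "\<dots> = log_weight x"
    using W_orthogonal[OF w] unfolding log_weight_def
    by (intro sum.cong) (simp_all add: k_W w Rpos_subset orthogonal_transformation_def)
  finally show ?thesis .
qed

lemma log_weight_diff_le:
  "log_weight x \<le> log_weight y + (\<Sum>\<alpha>\<in>Rpos. Re (k \<alpha>) * \<bar>\<alpha> \<bullet> (x - y)\<bar>)"
  unfolding log_weight_def sum.distrib[symmetric] distrib_left[symmetric]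
  by (intro sum_mono mult_left_mono Re_k_nonneg) (simp_all add: ln_one_plus_abs_le inner_diff_right)

lemma log_weight_mono:
  assumes "\<And>\<alpha>. \<alpha> \<in> Rpos \<Longrightarrow> \<bar>\<alpha> \<bullet> x\<bar> \<le> \<bar>\<alpha> \<bullet> y\<bar>"
  shows "log_weight x \<le> log_weight y"
  unfolding log_weight_def
  by (intro sum_mono mult_left_mono Re_k_nonneg) (simp_all add: assms add_pos_nonneg)

lemma norm_Omega_neg_half: "norm (Omega_neg_half Rpos k x) = exp (- log_weight x)"
proof -
  have "norm (complex_of_real (1 + \<bar>\<alpha> \<bullet> x\<bar>) powr (- k \<alpha>)) = exp (- (Re (k \<alpha>) * ln (1 + \<bar>\<alpha> \<bullet> x\<bar>)))" for \<alpha>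
    by (subst norm_powr_real) (auto intro: add_pos_nonneg)
  then show ?thesis
    by (simp only: Omega_neg_half_def log_weight_def exp_sum[OF finite_Rpos] prod_norm[symmetric] sum_negf[symmetric])
qed

section \<open>Geometry of the closed chamber\<close>

lemma regular_chamber_point:
  obtains v where "v \<in> chamber" "\<And>\<alpha>. \<alpha> \<in> Rpos \<Longrightarrow> 0 < \<alpha> \<bullet> v"
proof -
  obtain v where "Rpos = {\<alpha>\<in>R. \<alpha> \<bullet> v > 0}"
    using positive by (auto simp: positive_roots_def)
  then have v: "\<And>\<alpha>. \<alpha> \<in> Rpos \<Longrightarrow> 0 < \<alpha> \<bullet> v" by blast
  show ?thesis
    by (rule that[OF _ v]) (auto simp: chamber_def intro: order_less_imp_le[OF v])
qed

text \<open>Among the finitely many points \<open>w x\<close>, take one that maximizes the inner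
  product with an interior point \<open>v\<close> of the chamber. A reflection changes this product
  by \<open>- (\<alpha> \<bullet> w x) * (\<alpha> \<bullet> v)\<close>, so a negative
  \<open>\<alpha> \<bullet> w x\<close> would contradict maximality.\<close>

lemma W_conjugate_chamber:
  obtains w where "w \<in> W" "w x \<in> chamber"
proof -
  obtain v where v: "\<And>\<alpha>. \<alpha> \<in> Rpos \<Longrightarrow> 0 < \<alpha> \<bullet> v"
    by (rule regular_chamber_point) blast
  define w where "w = arg_min_on (\<lambda>w. - (v \<bullet> w x)) W"
  have ne: "W \<noteq> {}" using reflection_group.id by blast
  have w: "w \<in> W"
    unfolding w_def by (rule arg_min_if_finite(1)[OF finite_W ne])
  have max: "v \<bullet> u x \<le> v \<bullet> w x" if "u \<in> W" for u
    using arg_min_if_finite(2)[OF finite_W ne, of "\<lambda>w. - (v \<bullet> w x)", folded w_def] that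
    by force
  have "0 \<le> \<alpha> \<bullet> w x" if \<alpha>: "\<alpha> \<in> Rpos" for \<alpha>
  proof -
    have "v \<bullet> root_refl \<alpha> (w x) \<le> v \<bullet> w x"
      using max[OF reflection_group.comp[OF Rpos_subset[OF \<alpha>] w]] by simp
    then have "0 \<le> (\<alpha> \<bullet> w x) * (\<alpha> \<bullet> v)"
      by (simp add: root_refl_def inner_simps inner_commute)
    with v[OF \<alpha>] show ?thesis by (simp add: zero_le_mult_iff)
  qed
  with w show ?thesis by (intro that) (auto simp: chamber_def)
qed

lemma chamber_closed: "x \<in> chamber \<Longrightarrow> y \<in> chamber \<Longrightarrow> 0 \<le> c \<Longrightarrow> x + c *\<^sub>R y \<in> chamber"
  by (auto simp: chamber_def inner_simps)

lemma bounded_root_slab: "bounded {x. \<forall>\<alpha>\<in>R. \<bar>\<alpha> \<bullet> x\<bar> \<le> 1}"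
proof -
  have "\<exists>K. \<forall>x\<in>{x. \<forall>\<alpha>\<in>R. \<bar>\<alpha> \<bullet> x\<bar> \<le> 1}. \<bar>y \<bullet> x\<bar> \<le> K" for y
  proof -
    have "y \<in> span R" by (simp add: span_R)
    then show ?thesis
    proof (induction rule: span_induct_alt)
      case base
      show ?case by (intro exI[of _ 0]) simp
    next
      case (step c \<alpha> y)
      then obtain K where "\<forall>x\<in>{x. \<forall>\<alpha>\<in>R. \<bar>\<alpha> \<bullet> x\<bar> \<le> 1}. \<bar>y \<bullet> x\<bar> \<le> K" by blast
      with step(1) have "\<bar>(c *\<^sub>R \<alpha> + y) \<bullet> x\<bar> \<le> \<bar>c\<bar> * 1 + K" if "\<forall>\<alpha>\<in>R. \<bar>\<alpha> \<bullet> x\<bar> \<le> 1" for x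
        unfolding inner_add_left inner_scaleR_left using that
        by (intro order_trans[OF abs_triangle_ineq] add_mono) (auto simp: abs_mult mult_left_le)
      then show ?case by blast
    qed
  qed
  then have "\<forall>y. \<exists>K. \<forall>x\<in>{x. \<forall>\<alpha>\<in>R. \<bar>\<alpha> \<bullet> x\<bar> \<le> 1}. \<bar>y \<bullet> x\<bar> \<le> K" ..
  from choice[OF this] obtain K where
    K: "\<forall>y. \<forall>x\<in>{x. \<forall>\<alpha>\<in>R. \<bar>\<alpha> \<bullet> x\<bar> \<le> 1}. \<bar>y \<bullet> x\<bar> \<le> K y" ..
  show ?thesis
    unfolding bounded_iff
  proof (intro exI ballI)
    fix x :: 'a assume "x \<in> {x. \<forall>\<alpha>\<in>R. \<bar>\<alpha> \<bullet> x\<bar> \<le> 1}"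
    then have "(\<Sum>b\<in>Basis. \<bar>x \<bullet> b\<bar>) \<le> (\<Sum>b\<in>Basis. K b)"
      using K by (intro sum_mono) (simp add: inner_commute)
    then show "norm x \<le> (\<Sum>b\<in>Basis. K b)"
      using norm_le_l1[of x] by linarith
  qed
qed

text \<open>The chamber is the cone over its polytope section \<open>{x. (\<Sum>\<alpha>\<in>Rpos. \<alpha>) \<bullet> x \<le> 1}\<close>.\<close>

lemma chamber_finitely_generated:
  obtains S where "finite S" "S \<subseteq> chamber"
    "\<And>x. x \<in> chamber \<Longrightarrow> \<exists>c. (\<forall>e\<in>S. 0 \<le> c e) \<and> x = (\<Sum>e\<in>S. c e *\<^sub>R e)"
proof -
  define \<rho> where "\<rho> = (\<Sum>\<alpha>\<in>Rpos. \<alpha>)"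
  \<comment> \<open>Each \<open>\<beta> \<bullet> x\<close> with \<beta> positive is one of the
    nonnegative summands of \<open>\<rho> \<bullet> x\<close>. This bounds the section
    \<open>P\<close>, and it forces \<open>x = 0\<close> when
    \<open>\<rho> \<bullet> x = 0\<close>.\<close>
  have root_le: "\<bar>\<alpha> \<bullet> x\<bar> \<le> \<rho> \<bullet> x" if x: "x \<in> chamber" and \<alpha>: "\<alpha> \<in> R" for \<alpha> x
  proof -
    have *: "\<beta> \<bullet> x \<le> \<rho> \<bullet> x" "0 \<le> \<beta> \<bullet> x" if "\<beta> \<in> Rpos" for \<beta>
      unfolding \<rho>_def inner_sum_left using x that finite_Rpos
      by (auto simp: chamber_def intro!: member_le_sum)
    show ?thesis
      using Rpos_or[OF \<alpha>] *[of \<alpha>] *[of "- \<alpha>"] by auto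
  qed
  define P where "P = chamber \<inter> {x. \<rho> \<bullet> x \<le> 1}"
  have "polyhedron chamber"
  proof -
    have "chamber = \<Inter> ((\<lambda>\<alpha>. {x. \<alpha> \<bullet> x \<ge> 0}) ` Rpos)"
      by (auto simp: chamber_def)
    then show ?thesis
      using finite_Rpos by (auto intro: polyhedron_halfspace_ge)
  qed
  then have "polyhedron P"
    unfolding P_def by (intro polyhedron_Int polyhedron_halfspace_le)
  moreover have "bounded P"
    by (rule bounded_subset[OF bounded_root_slab]) (force simp: P_def dest: root_le)
  ultimately have "polytope P"
    by (simp add: polytope_eq_bounded_polyhedron)
  then obtain S where S: "finite S" "P = convex hull S"
    by (auto simp: polytope_def)
  show ?thesis
  proof (rule that[OF S(1)])
    show "S \<subseteq> chamber"
      using hull_subset[of S convex] S by (auto simp: P_def)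
    fix x assume x: "x \<in> chamber"
    show "\<exists>c. (\<forall>e\<in>S. 0 \<le> c e) \<and> x = (\<Sum>e\<in>S. c e *\<^sub>R e)"
    proof (cases "\<rho> \<bullet> x = 0")
      case True
      then have "\<forall>\<alpha>\<in>R. \<alpha> \<bullet> x = 0" using root_le[OF x] by auto
      then have "x \<bullet> x = 0"
        using orthogonal_to_span[of x R x] span_R by (auto simp: orthogonal_def inner_commute)
      then show ?thesis by (intro exI[of _ "\<lambda>_. 0"]) simp
    next
      case False
      have "0 \<le> \<rho> \<bullet> x"
        using x by (auto simp: \<rho>_def inner_sum_left chamber_def intro: sum_nonneg)
      with False have pos: "0 < \<rho> \<bullet> x" by simp
      then have "(1 / (\<rho> \<bullet> x)) *\<^sub>R x \<in> P"
        using x by (auto simp: P_def chamber_def)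
      then obtain u where u: "\<forall>e\<in>S. 0 \<le> u e" "(\<Sum>e\<in>S. u e *\<^sub>R e) = (1 / (\<rho> \<bullet> x)) *\<^sub>R x"
        using S convex_hull_finite[OF S(1)] by auto
      have "x = (\<rho> \<bullet> x) *\<^sub>R (\<Sum>e\<in>S. u e *\<^sub>R e)"
        using pos by (simp add: u(2))
      also have "\<dots> = (\<Sum>e\<in>S. ((\<rho> \<bullet> x) * u e) *\<^sub>R e)"
        by (simp add: scaleR_sum_right)
      finally show ?thesis
        using u(1) pos by (intro exI[of _ "\<lambda>e. (\<rho> \<bullet> x) * u e"]) auto
    qed
  qed
qed

end

section \<open>The system of the translates of a Dunkl eigenfunction\<close>

locale dunkl_solution = positive_root_system R Rpos k
  for R Rpos :: "'a::euclidean_space set" and k :: "'a \<Rightarrow> complex" +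
  fixes f :: "'a complexification \<Rightarrow> complex" and \<mu> :: 'a
  assumes eigenfunction: "dunkl_eigenfunction Rpos k (cscale \<i> (cplx_of \<mu>)) f"
    and regular: "\<mu> \<in> regular R"
begin

abbreviation spectral :: "'a complexification" where
  "spectral \<equiv> cscale \<i> (cplx_of \<mu>)"

definition F :: "('a \<Rightarrow> 'a) \<Rightarrow> 'a complexification \<Rightarrow> complex" where
  "F w z = f (cmap w z)"

definition amplitude :: "'a complexification \<Rightarrow> real" where
  "amplitude z = (\<Sum>w\<in>W. norm (F w z))"

lemma entire_f: "entire f"
  and dunkl_eq: "dunkl_op Rpos k \<xi> f z = cform (cplx_of \<xi>) spectral * f z"
  using eigenfunction unfolding dunkl_eigenfunction_def by blast+

lemma gateaux_entire_f: "gateaux_entire f"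
  by (rule entire_imp_gateaux_entire[OF entire_f])

lemma line_deriv_add: "line_deriv (u + v) f z = line_deriv u f z + line_deriv v f z"
  using linear_add[OF has_derivative_linear[OF entire_has_derivative[OF entire_f]]] by blast

text \<open>On a wall the reflection quotient is a normal derivative of \<open>f\<close>, which is
  not expressible by translates. The hypothesis makes \<open>u\<close> tangent to every wall through
  \<open>z\<close>, so the coefficient of that derivative vanishes; on the right the convention that
  division by 0 gives 0 drops the same term.\<close>

lemma line_deriv_f:
  assumes u: "\<And>\<alpha>. \<alpha> \<in> Rpos \<Longrightarrow> cform (cplx_of \<alpha>) z = 0 \<Longrightarrow> cform (cplx_of \<alpha>) u = 0"
  shows "line_deriv u f z = cform u spectral * f z -
    (\<Sum>\<alpha>\<in>Rpos. k \<alpha> * (cform (cplx_of \<alpha>) u / cform (cplx_of \<alpha>) z) * (f z - f (cmap (root_refl \<alpha>) z)))"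
proof -
  \<comment> \<open>The Dunkl equations are given for real directions; complex linearity of the
    derivative extends them to arbitrary \<open>u\<close>.\<close>
  have real: "line_deriv (cplx_of \<xi>) f z = cform (cplx_of \<xi>) spectral * f z -
      (\<Sum>\<alpha>\<in>Rpos. k \<alpha> * cform (cplx_of \<alpha>) (cplx_of \<xi>) * refl_quotient \<alpha> f z)" for \<xi>
    using dunkl_eq[of \<xi> z] unfolding dunkl_op_def dir_deriv_eq_line_deriv[OF gateaux_entire_f] cform_cplx_of
    by (simp add: algebra_simps)
  let ?u = "cplx_of (fst u) + cscale \<i> (cplx_of (snd u))"
  have "line_deriv u f z = line_deriv (cplx_of (fst u)) f z + \<i> * line_deriv (cplx_of (snd u)) f z"
    by (subst complexification_decomp) (simp only: line_deriv_add line_deriv_cscale[OF entire_f])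
  also have "\<dots> = cform ?u spectral * f z -
      (\<Sum>\<alpha>\<in>Rpos. k \<alpha> * cform (cplx_of \<alpha>) ?u * refl_quotient \<alpha> f z)"
    unfolding real cform_add_left cform_cscale_left cform_add_right cform_cscale_right
    by (simp add: algebra_simps sum.distrib sum_distrib_left)
  also have "?u = u"
    by (rule complexification_decomp[symmetric])
  also have "(\<Sum>\<alpha>\<in>Rpos. k \<alpha> * cform (cplx_of \<alpha>) u * refl_quotient \<alpha> f z) =
      (\<Sum>\<alpha>\<in>Rpos. k \<alpha> * (cform (cplx_of \<alpha>) u / cform (cplx_of \<alpha>) z) * (f z - f (cmap (root_refl \<alpha>) z)))"
    by (rule sum.cong) (auto simp: refl_quotient_def root_crefl_eq u)
  finally show ?thesis .
qed

text \<open>The equation is used at \<open>cmap w z\<close> in direction \<open>cmap w u\<close> and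
  reindexed by \<open>\<alpha> = w \<beta>\<close>. Since reflecting in \<open>w \<beta>\<close>
  after \<open>w\<close> equals \<open>w\<close> after reflecting in \<beta>, the coefficients no
  longer depend on \<open>w\<close> and the couplings are right multiplications in
  \<open>W\<close>.\<close>

lemma line_deriv_F:
  assumes w: "w \<in> W"
    and u: "\<And>\<alpha>. \<alpha> \<in> Rpos \<Longrightarrow> cform (cplx_of \<alpha>) z = 0 \<Longrightarrow> cform (cplx_of \<alpha>) u = 0"
  shows "line_deriv (cmap w u) f (cmap w z) = cform (cmap w u) spectral * F w z -
    (\<Sum>\<beta>\<in>Rpos. k \<beta> * (cform (cplx_of \<beta>) u / cform (cplx_of \<beta>) z) * (F w z - F (w \<circ> root_refl \<beta>) z))"
proof -
  note orth = W_orthogonal[OF w]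
  define h where "h \<alpha> = k \<alpha> * (cform (cplx_of \<alpha>) (cmap w u) / cform (cplx_of \<alpha>) (cmap w z)) *
    (f (cmap w z) - f (cmap (root_refl \<alpha>) (cmap w z)))" for \<alpha>
  \<comment> \<open>The preimage \<beta> of \<alpha> is a root but perhaps a negative one, so the
    tangency hypothesis is applied to \<beta> or to its opposite.\<close>
  have u': "cform (cplx_of \<alpha>) (cmap w u) = 0"
    if \<alpha>: "\<alpha> \<in> Rpos" and z: "cform (cplx_of \<alpha>) (cmap w z) = 0" for \<alpha>
  proof -
    have "\<alpha> \<in> w ` R" using W_image[OF w] Rpos_subset[OF \<alpha>] by simp
    then obtain \<beta> where \<beta>: "\<beta> \<in> R" "\<alpha> = w \<beta>" by blast
    show ?thesis
      using Rpos_or[OF \<beta>(1)] u[of \<beta>] u[of "- \<beta>"] z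
      by (auto simp: \<beta>(2) cform_cmap[OF orth] cform_uminus_left)
  qed
  have even: "h (- \<alpha>) = h \<alpha>" if "\<alpha> \<in> R" for \<alpha>
    unfolding h_def using that
    by (simp add: k_uminus cform_uminus_left) (simp add: root_refl_def[abs_def])
  have "line_deriv (cmap w u) f (cmap w z) = cform (cmap w u) spectral * F w z - (\<Sum>\<alpha>\<in>Rpos. h \<alpha>)"
    unfolding h_def F_def by (rule line_deriv_f[OF u'])
  also have "(\<Sum>\<alpha>\<in>Rpos. h \<alpha>) = (\<Sum>\<beta>\<in>Rpos. h (w \<beta>))"
    using sum_Rpos_W[of w h, OF w even] by simp
  also have "\<dots> = (\<Sum>\<beta>\<in>Rpos. k \<beta> * (cform (cplx_of \<beta>) u / cform (cplx_of \<beta>) z) *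
      (F w z - F (w \<circ> root_refl \<beta>) z))"
  proof (rule sum.cong[OF refl])
    fix \<beta> assume "\<beta> \<in> Rpos"
    have "cmap (root_refl (w \<beta>)) (cmap w z) = cmap (w \<circ> root_refl \<beta>) z"
      by (simp add: prod_eq_iff root_refl_orthogonal_transformation[OF orth])
    then show "h (w \<beta>) = k \<beta> * (cform (cplx_of \<beta>) u / cform (cplx_of \<beta>) z) *
        (F w z - F (w \<circ> root_refl \<beta>) z)"
      by (simp add: h_def k_W w Rpos_subset[OF \<open>\<beta> \<in> Rpos\<close>] cform_cmap[OF orth] F_def)
  qed
  finally show ?thesis .
qed

lemma F_along_path:
  assumes w: "w \<in> W" and \<gamma>: "(\<gamma> has_vector_derivative u) (at s)"
    and u: "\<And>\<alpha>. \<alpha> \<in> Rpos \<Longrightarrow> cform (cplx_of \<alpha>) (\<gamma> s) = 0 \<Longrightarrow> cform (cplx_of \<alpha>) u = 0"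
  shows "((\<lambda>s. F w (\<gamma> s)) has_vector_derivative
    cform (cmap w u) spectral * F w (\<gamma> s) -
    (\<Sum>\<beta>\<in>Rpos. k \<beta> * (cform (cplx_of \<beta>) u / cform (cplx_of \<beta>) (\<gamma> s)) *
      (F w (\<gamma> s) - F (w \<circ> root_refl \<beta>) (\<gamma> s)))) (at s)"
proof -
  have d: "((\<lambda>s. cmap w (\<gamma> s)) has_vector_derivative cmap w u) (at s)"
    by (rule bounded_linear.has_vector_derivative[OF bounded_linear_cmap[OF W_orthogonal[OF w]] \<gamma>])
  have "((\<lambda>s. f (cmap w (\<gamma> s))) has_derivative (\<lambda>h. line_deriv (h *\<^sub>R cmap w u) f (cmap w (\<gamma> s)))) (at s)"
    by (rule has_derivative_compose[OF d[unfolded has_vector_derivative_def] entire_has_derivative[OF entire_f]])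
  moreover have "line_deriv (h *\<^sub>R v) f z = h *\<^sub>R line_deriv v f z" for h v z
    using linear_scale[OF has_derivative_linear[OF entire_has_derivative[OF entire_f]]] by blast
  ultimately have "((\<lambda>s. F w (\<gamma> s)) has_vector_derivative line_deriv (cmap w u) f (cmap w (\<gamma> s))) (at s)"
    by (simp add: has_vector_derivative_def F_def)
  then show ?thesis
    by (simp only: line_deriv_F[OF w u])
qed

lemma norm_F_le_amplitude: "w \<in> W \<Longrightarrow> norm (F w z) \<le> amplitude z"
  unfolding amplitude_def using finite_W by (intro member_le_sum) auto

lemma amplitude_nonneg: "0 \<le> amplitude z"
  by (auto simp: amplitude_def intro: sum_nonneg)

lemma norm_f_le_amplitude: "norm (f z) \<le> amplitude z"
  using norm_F_le_amplitude[OF reflection_group.id, of z] by (simp add: F_def id_def map_prod_def)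

lemma amplitude_W:
  assumes v: "v \<in> W"
  shows "amplitude (cmap v z) = amplitude z"
proof -
  have "amplitude (cmap v z) = (\<Sum>w\<in>W. norm (F (w \<circ> v) z))"
    by (simp add: amplitude_def F_def cmap_cmap)
  then show ?thesis
    using sum_W_compose[OF v, of "\<lambda>w. norm (F w z)"] by (simp add: amplitude_def)
qed

lemma norm_cform_spectral_le:
  assumes "w \<in> W"
  shows "norm (cform (cmap w u) spectral) \<le> (norm (fst u) + norm (snd u)) * norm \<mu>"
proof -
  have "norm (w x) = norm x" for x
    using W_orthogonal[OF assms] by (simp add: orthogonal_transformation_norm)
  moreover have "norm (cform (cmap w u) spectral) \<le> \<bar>w (snd u) \<bullet> \<mu>\<bar> + \<bar>w (fst u) \<bullet> \<mu>\<bar>"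
    by (rule order_trans[OF cmod_le]) (simp add: cform_def cscale_cplx_of)
  ultimately show ?thesis
    using Cauchy_Schwarz_ineq2[of "w (fst u)" \<mu>] Cauchy_Schwarz_ineq2[of "w (snd u)" \<mu>]
    by (simp add: distrib_right)
qed

text \<open>Along a path off the walls the coefficients are logarithmic derivatives of the root
  forms, bounded by \<open>c\<close>. The summand with \<open>c'\<close> bounds the spectral term,
  and the factor 2 the difference of two translates.\<close>

lemma amplitude_path_le:
  fixes T c c' :: real
  assumes T: "0 \<le> T" and c: "0 \<le> c" "0 \<le> c'"
    and \<gamma>: "\<And>s. 0 \<le> s \<Longrightarrow> s \<le> T \<Longrightarrow> (\<gamma> has_vector_derivative \<gamma>' s) (at s)"
    and nz: "\<And>\<alpha> s. \<alpha> \<in> Rpos \<Longrightarrow> 0 \<le> s \<Longrightarrow> s \<le> T \<Longrightarrow> cform (cplx_of \<alpha>) (\<gamma> s) \<noteq> 0"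
    and ratio: "\<And>\<alpha> s. \<alpha> \<in> Rpos \<Longrightarrow> 0 \<le> s \<Longrightarrow> s \<le> T \<Longrightarrow>
      norm (cform (cplx_of \<alpha>) (\<gamma>' s)) \<le> c * norm (cform (cplx_of \<alpha>) (\<gamma> s))"
    and speed: "\<And>s. 0 \<le> s \<Longrightarrow> s \<le> T \<Longrightarrow> norm (fst (\<gamma>' s)) + norm (snd (\<gamma>' s)) \<le> c'"
  shows "amplitude (\<gamma> T) \<le>
    card W * exp ((c' * norm \<mu> + (\<Sum>\<alpha>\<in>Rpos. norm (k \<alpha>) * c * 2)) * card W * T) * amplitude (\<gamma> 0)"
  unfolding amplitude_def
proof (rule linear_system_growth[OF finite_W T])
  fix w s assume w: "w \<in> W" and s: "0 \<le> s" "s \<le> T"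
  show "((\<lambda>s. F w (\<gamma> s)) has_vector_derivative
    cform (cmap w (\<gamma>' s)) spectral * F w (\<gamma> s) -
    (\<Sum>\<beta>\<in>Rpos. k \<beta> * (cform (cplx_of \<beta>) (\<gamma>' s) / cform (cplx_of \<beta>) (\<gamma> s)) *
      (F w (\<gamma> s) - F (w \<circ> root_refl \<beta>) (\<gamma> s)))) (at s)"
    by (rule F_along_path[OF w \<gamma>[OF s]]) (use nz s in auto)
  have "norm (k \<beta> * (cform (cplx_of \<beta>) (\<gamma>' s) / cform (cplx_of \<beta>) (\<gamma> s)) *
      (F w (\<gamma> s) - F (w \<circ> root_refl \<beta>) (\<gamma> s))) \<le> norm (k \<beta>) * c * (2 * amplitude (\<gamma> s))"
    if \<beta>: "\<beta> \<in> Rpos" for \<beta>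
    unfolding norm_mult
  proof (intro mult_mono)
    show "norm (cform (cplx_of \<beta>) (\<gamma>' s) / cform (cplx_of \<beta>) (\<gamma> s)) \<le> c"
      using ratio[OF \<beta> s] nz[OF \<beta> s] by (simp add: norm_divide divide_le_eq)
    show "norm (F w (\<gamma> s) - F (w \<circ> root_refl \<beta>) (\<gamma> s)) \<le> 2 * amplitude (\<gamma> s)"
      using norm_F_le_amplitude[OF w, of "\<gamma> s"]
        norm_F_le_amplitude[OF W_compose[OF w root_refl_W[OF Rpos_subset[OF \<beta>]]], of "\<gamma> s"]
        norm_triangle_ineq4[of "F w (\<gamma> s)" "F (w \<circ> root_refl \<beta>) (\<gamma> s)"] by linarith
  qed (use c in auto)
  then have "norm (\<Sum>\<beta>\<in>Rpos. k \<beta> * (cform (cplx_of \<beta>) (\<gamma>' s) / cform (cplx_of \<beta>) (\<gamma> s)) *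
      (F w (\<gamma> s) - F (w \<circ> root_refl \<beta>) (\<gamma> s))) \<le> (\<Sum>\<alpha>\<in>Rpos. norm (k \<alpha>) * c * 2) * amplitude (\<gamma> s)"
    unfolding sum_distrib_right by (intro sum_norm_le) (simp add: mult.assoc)
  moreover have "norm (cform (cmap w (\<gamma>' s)) spectral * F w (\<gamma> s)) \<le> c' * norm \<mu> * amplitude (\<gamma> s)"
    unfolding norm_mult
    by (intro mult_mono order_trans[OF norm_cform_spectral_le[OF w]] mult_right_mono speed s norm_F_le_amplitude w)
       (use c in auto)
  ultimately show "norm (cform (cmap w (\<gamma>' s)) spectral * F w (\<gamma> s) -
    (\<Sum>\<beta>\<in>Rpos. k \<beta> * (cform (cplx_of \<beta>) (\<gamma>' s) / cform (cplx_of \<beta>) (\<gamma> s)) *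
      (F w (\<gamma> s) - F (w \<circ> root_refl \<beta>) (\<gamma> s))))
    \<le> (c' * norm \<mu> + (\<Sum>\<alpha>\<in>Rpos. norm (k \<alpha>) * c * 2)) * (\<Sum>w\<in>W. norm (F w (\<gamma> s)))"
    unfolding amplitude_def[symmetric] distrib_right
    by (intro order_trans[OF norm_triangle_ineq4] add_mono)
next
  show "0 \<le> c' * norm \<mu> + (\<Sum>\<alpha>\<in>Rpos. norm (k \<alpha>) * c * 2)"
    using c by (intro add_nonneg_nonneg sum_nonneg mult_nonneg_nonneg) auto
qed

section \<open>Decay in the chamber\<close>

context
  fixes x e :: 'a
  assumes x: "x \<in> chamber" and e: "e \<in> chamber"
begin

lemma F_along_ray:
  assumes w: "w \<in> W" and s: "0 < s"
  shows "((\<lambda>s. F w (cplx_of (x + s *\<^sub>R e))) has_vector_derivative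
    \<i> * (w e \<bullet> \<mu>) * F w (cplx_of (x + s *\<^sub>R e)) -
    (\<Sum>\<beta>\<in>Rpos. k \<beta> * of_real ((\<beta> \<bullet> e) / (\<beta> \<bullet> x + (\<beta> \<bullet> e) * s)) *
      (F w (cplx_of (x + s *\<^sub>R e)) - F (w \<circ> root_refl \<beta>) (cplx_of (x + s *\<^sub>R e))))) (at s)"
proof -
  have d: "((\<lambda>s. cplx_of (x + s *\<^sub>R e)) has_vector_derivative cplx_of e) (at s)"
    unfolding cplx_of_def by (auto intro!: derivative_eq_intros)
  \<comment> \<open>In the closed chamber both \<open>\<alpha> \<bullet> x\<close> and
    \<open>\<alpha> \<bullet> e\<close> are nonnegative, so for positive \<open>s\<close> the ray
    meets a wall only if it runs parallel to it.\<close>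
  have u: "cform (cplx_of \<alpha>) (cplx_of e) = 0"
    if \<alpha>: "\<alpha> \<in> Rpos" "cform (cplx_of \<alpha>) (cplx_of (x + s *\<^sub>R e)) = 0" for \<alpha>
  proof -
    have nn: "0 \<le> \<alpha> \<bullet> x" "0 \<le> \<alpha> \<bullet> e" using x e \<alpha>(1) by (auto simp: chamber_def)
    have "\<alpha> \<bullet> x + s * (\<alpha> \<bullet> e) = 0"
      using \<alpha>(2) by (simp only: cform_cplx_of of_real_eq_0_iff inner_add_right inner_scaleR_right)
    with nn s have "\<alpha> \<bullet> e = 0"
      by (simp add: add_nonneg_eq_0_iff)
    then show ?thesis by (simp add: cform_cplx_of)
  qed
  have q: "cform (cplx_of \<beta>) (cplx_of e) / cform (cplx_of \<beta>) (cplx_of (x + s *\<^sub>R e))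
      = of_real ((\<beta> \<bullet> e) / (\<beta> \<bullet> x + (\<beta> \<bullet> e) * s))" for \<beta>
    by (simp only: cform_cplx_of of_real_divide inner_add_right inner_scaleR_right mult.commute)
  have "cform (cmap w (cplx_of e)) spectral = \<i> * (w e \<bullet> \<mu>)"
    by (simp only: cmap_cplx_of[OF W_orthogonal[OF w]] cform_cscale_right cform_cplx_of)
  with F_along_path[OF w d u] show ?thesis
    by (simp only: q)
qed

text \<open>The spectral terms are imaginary and do not affect the energy. Each reflection term
  contributes \<open>- Re (k \<beta>)\<close> times a nonnegative coefficient times a nonnegative
  quadratic form, so the growth rate is 0.\<close>

lemma amplitude_along_ray_le:
  assumes s: "0 \<le> s"
  shows "amplitude (cplx_of (x + s *\<^sub>R e)) \<le> card W * amplitude (cplx_of x)"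
proof -
  let ?g = "\<lambda>w s. F w (cplx_of (x + s *\<^sub>R e))"
  have "(\<Sum>w\<in>W. norm (?g w s)) \<le> card W * exp (0 * s) * (\<Sum>w\<in>W. norm (?g w 0))"
  proof (rule energy_growth[OF finite_W s])
    fix w assume w: "w \<in> W"
    have "continuous_on {0..s} (\<lambda>s. cplx_of (x + s *\<^sub>R e))"
      unfolding cplx_of_def by (intro continuous_intros)
    then show "continuous_on {0..s} (?g w)"
      unfolding F_def
      by (intro gateaux_entire_compose_continuous[OF gateaux_entire_f]
          bounded_linear.continuous_on[OF bounded_linear_cmap[OF W_orthogonal[OF w]]])
    show "(?g w has_vector_derivative \<i> * (w e \<bullet> \<mu>) * ?g w t -
      (\<Sum>\<beta>\<in>Rpos. k \<beta> * of_real ((\<beta> \<bullet> e) / (\<beta> \<bullet> x + (\<beta> \<bullet> e) * t)) *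
       (?g w t - ?g (w \<circ> root_refl \<beta>) t))) (at t)" if "0 < t" for t
      by (rule F_along_ray[OF w that])
  next
    fix t :: real assume t: "0 < t"
    let ?c = "\<lambda>\<beta>. (\<beta> \<bullet> e) / (\<beta> \<bullet> x + (\<beta> \<bullet> e) * t)"
    let ?Z = "\<lambda>\<beta>. \<Sum>w\<in>W. cnj (?g w t) * (?g w t - ?g (w \<circ> root_refl \<beta>) t)"
    have Z: "0 \<le> Re (k \<beta> * of_real (?c \<beta>) * ?Z \<beta>)" if \<beta>: "\<beta> \<in> Rpos" for \<beta>
    proof -
      note \<beta>R = Rpos_subset[OF \<beta>]
      have half: "Z = of_real (N / 2)" if "2 * Z = of_real N" for Z :: complex and N :: real
        using that by (simp add: complex_eq_iff)
      \<comment> \<open>Averaging over the involution of \<open>W\<close> given by right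
        multiplication with the reflection turns the form into half a sum of squares. In particular
        it is real, so only the real part of \<open>k \<beta>\<close> enters.\<close>
      have "?Z \<beta> = (\<Sum>w\<in>W. cnj (?g (w \<circ> root_refl \<beta>) t) *
          (?g (w \<circ> root_refl \<beta>) t - ?g (w \<circ> root_refl \<beta> \<circ> root_refl \<beta>) t))"
        by (rule sum_W_compose[OF root_refl_W[OF \<beta>R], symmetric])
      then have "2 * ?Z \<beta> = (\<Sum>w\<in>W. cnj (?g w t) * (?g w t - ?g (w \<circ> root_refl \<beta>) t)
          + cnj (?g (w \<circ> root_refl \<beta>) t) * (?g (w \<circ> root_refl \<beta>) t - ?g w t))"
        by (simp add: comp_assoc root_refl_involution[OF \<beta>R] sum.distrib)
      also have "\<dots> = (\<Sum>w\<in>W. of_real ((norm (?g w t - ?g (w \<circ> root_refl \<beta>) t))\<^sup>2))"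
        unfolding complex_norm_square by (intro sum.cong) (simp_all add: algebra_simps)
      finally have "2 * ?Z \<beta> = of_real (\<Sum>w\<in>W. (norm (?g w t - ?g (w \<circ> root_refl \<beta>) t))\<^sup>2)"
        by simp
      from half[OF this]
      have "?Z \<beta> = of_real ((\<Sum>w\<in>W. (norm (?g w t - ?g (w \<circ> root_refl \<beta>) t))\<^sup>2) / 2)" .
      note Z = this
      have Re_mult: "Re (a * of_real c * of_real d) = Re a * c * d" for a :: complex and c d :: real
        by simp
      have "0 \<le> ?c \<beta>"
        using x e \<beta> t by (auto simp: chamber_def)
      then show ?thesis
        unfolding Z Re_mult by (intro mult_nonneg_nonneg Re_k_nonneg[OF \<beta>]) (auto intro: sum_nonneg)
    qed
    have expand: "cnj a * (\<i> * \<theta> * a - (\<Sum>\<beta>\<in>Rpos. \<kappa> \<beta> * (a - b \<beta>)))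
        = \<i> * \<theta> * (a * cnj a) - (\<Sum>\<beta>\<in>Rpos. \<kappa> \<beta> * (cnj a * (a - b \<beta>)))" for a \<theta> and \<kappa> b :: "'a \<Rightarrow> complex"
      by (simp add: right_diff_distrib sum_distrib_left mult_ac)
    have "(\<Sum>w\<in>W. cnj (?g w t) * (\<i> * (w e \<bullet> \<mu>) * ?g w t -
        (\<Sum>\<beta>\<in>Rpos. k \<beta> * of_real (?c \<beta>) * (?g w t - ?g (w \<circ> root_refl \<beta>) t))))
      = (\<Sum>w\<in>W. \<i> * (w e \<bullet> \<mu>) * (?g w t * cnj (?g w t))) -
        (\<Sum>w\<in>W. \<Sum>\<beta>\<in>Rpos. k \<beta> * of_real (?c \<beta>) * (cnj (?g w t) * (?g w t - ?g (w \<circ> root_refl \<beta>) t)))"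
      unfolding expand sum_subtractf ..
    also have "\<dots> = (\<Sum>w\<in>W. \<i> * (w e \<bullet> \<mu>) * of_real ((norm (?g w t))\<^sup>2)) - (\<Sum>\<beta>\<in>Rpos. k \<beta> * of_real (?c \<beta>) * ?Z \<beta>)"
      by (subst sum.swap) (simp only: complex_norm_square sum_distrib_left)
    finally have "Re (\<Sum>w\<in>W. cnj (?g w t) * (\<i> * (w e \<bullet> \<mu>) * ?g w t -
        (\<Sum>\<beta>\<in>Rpos. k \<beta> * of_real (?c \<beta>) * (?g w t - ?g (w \<circ> root_refl \<beta>) t))))
      = - (\<Sum>\<beta>\<in>Rpos. Re (k \<beta> * of_real (?c \<beta>) * ?Z \<beta>))"
      by (simp only: minus_complex.sel Re_sum) simp
    also have "\<dots> \<le> 0"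
      using Z by (simp add: sum_nonneg)
    finally show "Re (\<Sum>w\<in>W. cnj (?g w t) * (\<i> * (w e \<bullet> \<mu>) * ?g w t -
        (\<Sum>\<beta>\<in>Rpos. k \<beta> * of_real (?c \<beta>) * (?g w t - ?g (w \<circ> root_refl \<beta>) t))))
      \<le> 0 * (\<Sum>w\<in>W. (norm (?g w t))\<^sup>2)"
      by simp
  qed
  then show ?thesis by (simp add: amplitude_def)
qed

end

end

text \<open>Pigeonhole: each \<open>\<alpha>\<close> in \<open>A\<close> excludes at most the one
  integer to which \<open>q \<alpha>\<close> rounds, and there is one candidate more than elements
  of \<open>A\<close>. In the application \<open>q \<alpha>\<close> is the radius at which the
  circle could meet the wall of \<alpha>.\<close>

lemma avoiding_radius:
  fixes q :: "'b \<Rightarrow> real"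
  assumes "finite A"
  obtains j :: nat where "1 \<le> j" "j \<le> card A + 1" "\<And>\<alpha>. \<alpha> \<in> A \<Longrightarrow> 1 / 2 \<le> \<bar>q \<alpha> - j\<bar>"
proof -
  have "card ((\<lambda>\<alpha>. nat (round (q \<alpha>))) ` A) < card {1..card A + 1}"
    using card_image_le[OF assms, of "\<lambda>\<alpha>. nat (round (q \<alpha>))"] by simp
  then have "\<not> {1..card A + 1} \<subseteq> (\<lambda>\<alpha>. nat (round (q \<alpha>))) ` A"
    using card_mono[of "(\<lambda>\<alpha>. nat (round (q \<alpha>))) ` A"] assms by (metis finite_imageI not_le)
  then obtain j where j: "j \<in> {1..card A + 1}" "j \<notin> (\<lambda>\<alpha>. nat (round (q \<alpha>))) ` A"
    by blast
  have "1 / 2 \<le> \<bar>q \<alpha> - j\<bar>" if "\<alpha> \<in> A" for \<alpha>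
  proof (rule ccontr)
    assume "\<not> ?thesis"
    then have "round (q \<alpha>) = int j" by (intro round_unique') simp
    then have "nat (round (q \<alpha>)) = j" by simp
    with j(2) that show False by blast
  qed
  with j(1) show ?thesis by (intro that) auto
qed

section \<open>Weighted decay, uniform in the starting point\<close>

context dunkl_solution
begin

text \<open>\<open>C\<close> must not depend on \<open>x\<close>, which may lie on walls or far out.
  The energy estimate covers times up to \<open>S0\<close>, where the weight grows boundedly; later
  the oscillation estimate applies with offsets \<open>\<beta> \<bullet> x\<close>.\<close>

lemma decay_along_ray:
  assumes e: "e \<in> chamber"
  obtains C where "0 \<le> C"
    "\<And>x s. x \<in> chamber \<Longrightarrow> 0 \<le> s \<Longrightarrow>
      amplitude (cplx_of (x + s *\<^sub>R e)) * exp (log_weight (x + s *\<^sub>R e))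
      \<le> C * (amplitude (cplx_of x) * exp (log_weight x))"
proof -
  \<comment> \<open>Only these roots couple translates along the ray, and only their weight factors
    vary.\<close>
  define B where "B = {\<beta>\<in>Rpos. 0 < \<beta> \<bullet> e}"
  have B: "finite B" "\<And>\<beta>. \<beta> \<in> B \<Longrightarrow> \<beta> \<in> Rpos" "\<And>\<beta>. \<beta> \<in> B \<Longrightarrow> 0 < \<beta> \<bullet> e"
    using finite_Rpos by (auto simp: B_def)
  have notB: "\<beta> \<bullet> e = 0" if "\<beta> \<in> Rpos" "\<beta> \<notin> B" for \<beta>
    using e that by (fastforce simp: B_def chamber_def)
  \<comment> \<open>The frequency difference is
    \<open>(\<beta> \<bullet> e) * (w \<beta> \<bullet> \<mu>)\<close> up to sign. Regularity of
    \<mu>, applied to the root \<open>w \<beta>\<close>, enters here.\<close>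
  have \<theta>: "(w \<circ> root_refl \<beta>) e \<bullet> \<mu> \<noteq> w e \<bullet> \<mu>" if "\<beta> \<in> B" "w \<in> W" for \<beta> w
  proof -
    have "(w \<circ> root_refl \<beta>) e \<bullet> \<mu> = w e \<bullet> \<mu> - (\<beta> \<bullet> e) * (w \<beta> \<bullet> \<mu>)"
      using orthogonal_transformation_linear[OF W_orthogonal[OF that(2)]]
      by (simp add: root_refl_def linear_diff linear_scale inner_diff_left)
    moreover have "w \<beta> \<bullet> \<mu> \<noteq> 0"
      using regular W_root[OF that(2) Rpos_subset[OF B(2)[OF that(1)]]] by (simp add: regular_def)
    ultimately show ?thesis using B(3)[OF that(1)] by simp
  qed
  have \<sigma>: "w \<circ> root_refl \<beta> \<in> W" if "\<beta> \<in> B" "w \<in> W" for \<beta> w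
    by (intro W_compose root_refl_W Rpos_subset B that)
  note bound = oscillating_system_bound[where I = W and B = B and \<sigma> = "\<lambda>\<beta> w. w \<circ> root_refl \<beta>" and \<kappa> = k
      and b = "\<lambda>\<beta>. \<beta> \<bullet> e" and \<theta> = "\<lambda>w. w e \<bullet> \<mu>", OF finite_W B(1) \<sigma> \<theta> B(3)]
  obtain S0 where S0: "0 < S0" and osc: "\<forall>\<tau> g s. (\<forall>\<beta>\<in>B. 0 \<le> \<tau> \<beta>) \<longrightarrow>
     (\<forall>w\<in>W. \<forall>s\<ge>S0. (g w has_vector_derivative
       \<i> * (w e \<bullet> \<mu>) * g w s - (\<Sum>\<beta>\<in>B. k \<beta> * of_real ((\<beta> \<bullet> e) / (\<tau> \<beta> + (\<beta> \<bullet> e) * s)) *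
         (g w s - g (w \<circ> root_refl \<beta>) s))) (at s)) \<longrightarrow>
     S0 \<le> s \<longrightarrow>
     (\<Sum>w\<in>W. norm (g w s)) * exp (\<Sum>\<beta>\<in>B. Re (k \<beta>) * ln (\<tau> \<beta> + (\<beta> \<bullet> e) * s))
     \<le> 2 * ((\<Sum>w\<in>W. norm (g w S0)) * exp (\<Sum>\<beta>\<in>B. Re (k \<beta>) * ln (\<tau> \<beta> + (\<beta> \<bullet> e) * S0)))"
    by (rule exE[OF bound], assumption, assumption, assumption, assumption, assumption, elim conjE, rule that)
  \<comment> \<open>\<open>K1\<close> is the price of replacing \<open>1 + t\<close> by
    \<open>t\<close> after time \<open>S0\<close>; \<open>K2\<close> bounds the growth of the
    logarithmic weight before it.\<close>
  define K1 where "K1 = (\<Sum>\<beta>\<in>B. Re (k \<beta>) * ln (1 + 1 / ((\<beta> \<bullet> e) * S0)))"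
  define K2 where "K2 = (\<Sum>\<beta>\<in>Rpos. Re (k \<beta>) * (S0 * \<bar>\<beta> \<bullet> e\<bar>))"
  define n where "n = real (card W)"
  have K1: "0 \<le> K1"
    unfolding K1_def using B S0 by (intro sum_nonneg mult_nonneg_nonneg Re_k_nonneg ln_ge_zero) (auto dest: B(3))
  have n: "0 \<le> n" by (simp add: n_def)
  show ?thesis
  proof (rule that)
    show "0 \<le> 2 * exp K1 * (n * exp K2)" using n by simp
    fix x s assume x: "x \<in> chamber" and s: "(0::real) \<le> s"
    let ?A = "\<lambda>s. amplitude (cplx_of (x + s *\<^sub>R e))" and ?L = "\<lambda>s. log_weight (x + s *\<^sub>R e)"
    let ?t = "\<lambda>\<beta> s. \<beta> \<bullet> x + (\<beta> \<bullet> e) * s"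
    have short: "?A s * exp (?L s) \<le> (n * exp K2) * (?A 0 * exp (?L 0))" if s: "0 \<le> s" "s \<le> S0" for s
    proof -
      have "(\<Sum>\<beta>\<in>Rpos. Re (k \<beta>) * \<bar>\<beta> \<bullet> ((x + s *\<^sub>R e) - x)\<bar>) \<le> K2"
        unfolding K2_def using s
        by (intro sum_mono mult_left_mono Re_k_nonneg) (simp_all add: abs_mult mult_right_mono)
      then have "?L s \<le> K2 + log_weight x"
        using log_weight_diff_le[of "x + s *\<^sub>R e" x] by linarith
      then have "?A s * exp (?L s) \<le> (n * amplitude (cplx_of x)) * exp (K2 + log_weight x)"
        using amplitude_along_ray_le[OF x e s(1)] n
        by (intro mult_mono mult_nonneg_nonneg amplitude_nonneg) (auto simp: n_def)
      then show ?thesis by (simp add: exp_add mult_ac)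
    qed
    have final: "2 * exp K1 * (n * exp K2) * (amplitude (cplx_of x) * exp (log_weight x))
        = 2 * exp K1 * ((n * exp K2) * (?A 0 * exp (?L 0)))"
      by simp
    show "?A s * exp (?L s) \<le> 2 * exp K1 * (n * exp K2) * (amplitude (cplx_of x) * exp (log_weight x))"
    proof (cases "s \<le> S0")
      case True
      have "1 \<le> 2 * exp K1" using K1 by (simp add: order_trans[of 1 "exp K1"])
      then have "1 * ((n * exp K2) * (?A 0 * exp (?L 0))) \<le> 2 * exp K1 * ((n * exp K2) * (?A 0 * exp (?L 0)))"
        using n by (intro mult_right_mono mult_nonneg_nonneg amplitude_nonneg) auto
      with short[OF s True] show ?thesis unfolding final by linarith
    next
      case False
      then have sS: "S0 \<le> s" by simp
      have \<tau>: "0 \<le> \<beta> \<bullet> x" if "\<beta> \<in> Rpos" for \<beta>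
        using x that by (auto simp: chamber_def)
      have "(\<Sum>w\<in>W. norm (F w (cplx_of (x + s *\<^sub>R e)))) * exp (\<Sum>\<beta>\<in>B. Re (k \<beta>) * ln (?t \<beta> s))
        \<le> 2 * ((\<Sum>w\<in>W. norm (F w (cplx_of (x + S0 *\<^sub>R e)))) * exp (\<Sum>\<beta>\<in>B. Re (k \<beta>) * ln (?t \<beta> S0)))"
      proof (rule osc[rule_format, of "\<lambda>\<beta>. \<beta> \<bullet> x" "\<lambda>w s. F w (cplx_of (x + s *\<^sub>R e))", OF _ _ sS])
        show "0 \<le> \<beta> \<bullet> x" if "\<beta> \<in> B" for \<beta> using \<tau> B(2) that by blast
        fix w t assume w: "w \<in> W" and t: "S0 \<le> t"
        let ?h = "\<lambda>\<beta>. k \<beta> * of_real ((\<beta> \<bullet> e) / ?t \<beta> t) *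
           (F w (cplx_of (x + t *\<^sub>R e)) - F (w \<circ> root_refl \<beta>) (cplx_of (x + t *\<^sub>R e)))"
        have "(\<Sum>\<beta>\<in>Rpos. ?h \<beta>) = (\<Sum>\<beta>\<in>B. ?h \<beta>)"
          by (rule sum.mono_neutral_right[OF finite_Rpos]) (auto simp: notB B(2))
        then show "((\<lambda>s. F w (cplx_of (x + s *\<^sub>R e))) has_vector_derivative
          \<i> * (w e \<bullet> \<mu>) * F w (cplx_of (x + t *\<^sub>R e)) - (\<Sum>\<beta>\<in>B. ?h \<beta>)) (at t)"
          using F_along_ray[OF x e w less_le_trans[OF S0 t]] by simp
      qed
      then have osc': "?A s * exp (\<Sum>\<beta>\<in>B. Re (k \<beta>) * ln (?t \<beta> s))
        \<le> 2 * (?A S0 * exp (\<Sum>\<beta>\<in>B. Re (k \<beta>) * ln (?t \<beta> S0)))"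
        by (simp add: amplitude_def)
      \<comment> \<open>The weight at \<open>s\<close> is compared with the weight at
        \<open>S0\<close> root by root: factors outside \<open>B\<close> agree, the others follow
        the growth of the homogeneous factors up to \<open>K1\<close>.\<close>
      have "?L s \<le> (\<Sum>\<beta>\<in>Rpos. Re (k \<beta>) * ln (1 + \<bar>\<beta> \<bullet> (x + S0 *\<^sub>R e)\<bar>) +
        (if 0 < \<beta> \<bullet> e then Re (k \<beta>) * ln (?t \<beta> s) - Re (k \<beta>) * ln (?t \<beta> S0)
           + Re (k \<beta>) * ln (1 + 1 / ((\<beta> \<bullet> e) * S0)) else 0))"
        unfolding log_weight_def
      proof (rule sum_mono)
        fix \<beta> assume \<beta>: "\<beta> \<in> Rpos"
        show "Re (k \<beta>) * ln (1 + \<bar>\<beta> \<bullet> (x + s *\<^sub>R e)\<bar>) \<le> Re (k \<beta>) * ln (1 + \<bar>\<beta> \<bullet> (x + S0 *\<^sub>R e)\<bar>) +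
        (if 0 < \<beta> \<bullet> e then Re (k \<beta>) * ln (?t \<beta> s) - Re (k \<beta>) * ln (?t \<beta> S0)
           + Re (k \<beta>) * ln (1 + 1 / ((\<beta> \<bullet> e) * S0)) else 0)"
        proof (cases "0 < \<beta> \<bullet> e")
          case True
          have S0t: "0 < (\<beta> \<bullet> e) * S0" "(\<beta> \<bullet> e) * S0 \<le> ?t \<beta> s" "0 < ?t \<beta> S0"
            using True S0 sS \<tau>[OF \<beta>] by (auto intro: add_nonneg_pos order_trans[OF mult_left_mono[OF sS]])
          have ln_t: "ln (?t \<beta> S0) \<le> ln (1 + ?t \<beta> S0)"
            using S0t(3) by (intro ln_mono) auto
          have abs_t: "\<bar>\<beta> \<bullet> (x + r *\<^sub>R e)\<bar> = ?t \<beta> r" if "0 \<le> r" for r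
            using \<tau>[OF \<beta>] True that by (simp add: inner_simps mult.commute)
          note ln_one_plus_le[OF S0t(1,2)]
          then have "ln (1 + ?t \<beta> s) \<le> ln (1 + ?t \<beta> S0) + (ln (?t \<beta> s) - ln (?t \<beta> S0) + ln (1 + 1 / ((\<beta> \<bullet> e) * S0)))"
            using ln_t by linarith
          from mult_left_mono[OF this Re_k_nonneg[OF \<beta>]] show ?thesis
            using True s S0 by (simp add: abs_t distrib_left right_diff_distrib)
        qed (use e \<beta> in \<open>force simp: inner_simps chamber_def\<close>)
      qed
      also have "\<dots> = ?L S0 + ((\<Sum>\<beta>\<in>B. Re (k \<beta>) * ln (?t \<beta> s)) - (\<Sum>\<beta>\<in>B. Re (k \<beta>) * ln (?t \<beta> S0)) + K1)"
        unfolding sum.distrib sum.inter_filter[OF finite_Rpos, symmetric] B_def[symmetric]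
        by (simp add: log_weight_def K1_def sum.distrib sum_subtractf)
      finally have "exp (?L s) \<le> exp (\<Sum>\<beta>\<in>B. Re (k \<beta>) * ln (?t \<beta> s)) *
          (exp (?L S0) * exp (- (\<Sum>\<beta>\<in>B. Re (k \<beta>) * ln (?t \<beta> S0))) * exp K1)"
        by (simp flip: exp_add)
      then have "?A s * exp (?L s) \<le> (?A s * exp (\<Sum>\<beta>\<in>B. Re (k \<beta>) * ln (?t \<beta> s))) *
          (exp (?L S0) * exp (- (\<Sum>\<beta>\<in>B. Re (k \<beta>) * ln (?t \<beta> S0))) * exp K1)"
        unfolding mult.assoc by (intro mult_left_mono amplitude_nonneg) simp
      also have "\<dots> \<le> (2 * (?A S0 * exp (\<Sum>\<beta>\<in>B. Re (k \<beta>) * ln (?t \<beta> S0)))) *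
          (exp (?L S0) * exp (- (\<Sum>\<beta>\<in>B. Re (k \<beta>) * ln (?t \<beta> S0))) * exp K1)"
        by (intro mult_right_mono osc') simp
      also have "\<dots> = 2 * exp K1 * (?A S0 * exp (?L S0))"
        by (simp add: exp_minus)
      also have "\<dots> \<le> 2 * exp K1 * ((n * exp K2) * (?A 0 * exp (?L 0)))"
        using short[of S0] S0 by (intro mult_left_mono) auto
      finally show ?thesis unfolding final .
    qed
  qed
qed

text \<open>Each generator adds one ray, starting from the point already reached. Uniformity of the
  ray estimate lets the constants multiply, starting from the value at 0.\<close>

lemma decay_in_cone:
  assumes "finite S" "S \<subseteq> chamber"
  shows "\<exists>C\<ge>0. \<forall>c. (\<forall>e\<in>S. 0 \<le> c e) \<longrightarrow>
    amplitude (cplx_of (\<Sum>e\<in>S. c e *\<^sub>R e)) * exp (log_weight (\<Sum>e\<in>S. c e *\<^sub>R e)) \<le> C"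
  using assms
proof (induction S rule: finite_induct)
  case empty
  show ?case by (intro exI[of _ "amplitude (cplx_of 0) * exp (log_weight 0)"]) (simp add: amplitude_nonneg)
next
  case (insert e S)
  then obtain C where C: "0 \<le> C" "\<And>c. (\<forall>e\<in>S. 0 \<le> c e) \<Longrightarrow>
    amplitude (cplx_of (\<Sum>e\<in>S. c e *\<^sub>R e)) * exp (log_weight (\<Sum>e\<in>S. c e *\<^sub>R e)) \<le> C"
    by auto
  from insert have "e \<in> chamber" by simp
  then obtain C' where C': "0 \<le> C'" "\<And>x s. x \<in> chamber \<Longrightarrow> 0 \<le> s \<Longrightarrow>
      amplitude (cplx_of (x + s *\<^sub>R e)) * exp (log_weight (x + s *\<^sub>R e))
      \<le> C' * (amplitude (cplx_of x) * exp (log_weight x))"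
    by (rule decay_along_ray) blast
  have "amplitude (cplx_of (\<Sum>e\<in>insert e S. c e *\<^sub>R e)) * exp (log_weight (\<Sum>e\<in>insert e S. c e *\<^sub>R e)) \<le> C' * C"
    if c: "\<forall>e\<in>insert e S. 0 \<le> c e" for c
  proof -
    let ?x = "\<Sum>e\<in>S. c e *\<^sub>R e"
    have "?x \<in> chamber"
      using insert c by (auto simp: chamber_def inner_sum_right intro!: sum_nonneg mult_nonneg_nonneg)
    then have "amplitude (cplx_of (?x + c e *\<^sub>R e)) * exp (log_weight (?x + c e *\<^sub>R e))
        \<le> C' * (amplitude (cplx_of ?x) * exp (log_weight ?x))"
      using c by (intro C') auto
    also have "\<dots> \<le> C' * C"
      using c by (intro mult_left_mono C C') auto
    finally show ?thesis
      using insert by (simp add: add.commute)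
  qed
  with C(1) C'(1) show ?case by (intro exI[of _ "C' * C"]) auto
qed

lemma decay_in_chamber:
  obtains C where "0 \<le> C" "\<And>x. x \<in> chamber \<Longrightarrow> amplitude (cplx_of x) \<le> C * exp (- log_weight x)"
proof -
  obtain S where S: "finite S" "S \<subseteq> chamber"
    "\<And>x. x \<in> chamber \<Longrightarrow> \<exists>c. (\<forall>e\<in>S. 0 \<le> c e) \<and> x = (\<Sum>e\<in>S. c e *\<^sub>R e)"
    by (rule chamber_finitely_generated) blast
  obtain C where C: "0 \<le> C" "\<And>c. (\<forall>e\<in>S. 0 \<le> c e) \<Longrightarrow>
    amplitude (cplx_of (\<Sum>e\<in>S. c e *\<^sub>R e)) * exp (log_weight (\<Sum>e\<in>S. c e *\<^sub>R e)) \<le> C"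
    using decay_in_cone[OF S(1,2)] by blast
  show ?thesis
  proof (rule that[OF C(1)])
    fix x assume "x \<in> chamber"
    then obtain c where c: "\<forall>e\<in>S. 0 \<le> c e" "x = (\<Sum>e\<in>S. c e *\<^sub>R e)" using S(3) by blast
    have "amplitude (cplx_of x) * exp (log_weight x) * exp (- log_weight x) \<le> C * exp (- log_weight x)"
      unfolding c(2) by (intro mult_right_mono C(2) c) auto
    then show "amplitude (cplx_of x) \<le> C * exp (- log_weight x)"
      by (simp add: mult.assoc flip: exp_add)
  qed
qed

end

section \<open>Bounds on complex tubes\<close>

lemma cmap_line:
  "linear w \<Longrightarrow> cmap w (z + cscale c u) = cmap w z + cscale c (cmap w u)"
  by (simp add: cscale_def prod_eq_iff linear_add linear_diff linear_scale)

context dunkl_solution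
begin

text \<open>Near a wall the system is singular. The point \<open>(x, y)\<close> is enclosed by a circle in the complex
  line in direction \<open>v\<close> that stays away from all walls. The circle is joined to the real point
  \<open>x + j v\<close> by a path along which the system is regular, and the maximum principle applies.\<close>

lemma amplitude_tube_chamber:
  obtains C where "0 \<le> C"
    "\<And>x y. x \<in> chamber \<Longrightarrow> norm y \<le> 1 \<Longrightarrow> amplitude (x, y) \<le> C * exp (- log_weight x)"
proof -
  obtain v where v: "v \<in> chamber" "\<And>\<alpha>. \<alpha> \<in> Rpos \<Longrightarrow> 0 < \<alpha> \<bullet> v"
    by (rule regular_chamber_point) blast
  obtain C0 where C0: "0 \<le> C0" "\<And>x. x \<in> chamber \<Longrightarrow> amplitude (cplx_of x) \<le> C0 * exp (- log_weight x)"
    by (rule decay_in_chamber) blast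
  define b where "b = Min (insert 1 ((\<lambda>\<alpha>. \<alpha> \<bullet> v) ` Rpos))"
  have b: "0 < b" "\<And>\<alpha>. \<alpha> \<in> Rpos \<Longrightarrow> b \<le> \<alpha> \<bullet> v"
    using finite_Rpos v(2) by (auto simp: b_def)
  define N where "N = real (card Rpos + 1)"
  define n where "n = real (card W)"
  define K1 where "K1 = n * exp ((1 * norm \<mu> + (\<Sum>\<alpha>\<in>Rpos. norm (k \<alpha>) * (2 / b) * 2)) * n * 1)"
  define L where "L = N * norm v * 2 * norm \<mu> + (\<Sum>\<alpha>\<in>Rpos. norm (k \<alpha>) * (2 * N) * 2)"
  define K2 where "K2 = n * exp (L * n * (2 * pi))"
  have n: "0 \<le> n" and N: "0 \<le> N" and K: "0 \<le> K1" "0 \<le> K2"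
    by (simp_all add: n_def N_def K1_def K2_def)
  have L: "0 \<le> L"
    unfolding L_def using N by (intro add_nonneg_nonneg sum_nonneg mult_nonneg_nonneg) auto
  show ?thesis
  proof (rule that)
    show "0 \<le> n * (K2 * (K1 * C0))"
      using n K C0 by simp
    fix x y :: 'a assume x: "x \<in> chamber" and y: "norm y \<le> 1"
    \<comment> \<open>The root form at \<open>(x, y)\<close> shifted by \<zeta> times
      \<open>v\<close> vanishes only if the modulus of \<zeta> is that of the form at
      \<open>(x, y)\<close> divided by \<open>\<alpha> \<bullet> v\<close>. A radius
      \<open>j\<close> at distance at least 1/2 from all these values keeps the circle off the
      walls, while \<open>j\<close> stays bounded independently of \<open>x\<close> and
      \<open>y\<close>.\<close>
    obtain j :: nat where j: "1 \<le> j" "j \<le> card Rpos + 1"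
      and far: "\<And>\<alpha>. \<alpha> \<in> Rpos \<Longrightarrow> 1 / 2 \<le> \<bar>norm (cform (cplx_of \<alpha>) (x, y)) / (\<alpha> \<bullet> v) - j\<bar>"
      by (rule avoiding_radius[OF finite_Rpos, where q = "\<lambda>\<alpha>. norm (cform (cplx_of \<alpha>) (x, y)) / (\<alpha> \<bullet> v)"]) blast
    have jN: "real j \<le> N" using j(2) by (simp add: N_def)
    have pos: "b \<le> \<alpha> \<bullet> (x + real j *\<^sub>R v)" if \<alpha>: "\<alpha> \<in> Rpos" for \<alpha>
    proof -
      have "1 * b \<le> real j * (\<alpha> \<bullet> v)"
        using j b \<alpha> by (intro mult_mono) auto
      moreover have "0 \<le> \<alpha> \<bullet> x" using x \<alpha> by (auto simp: chamber_def)
      ultimately show ?thesis by (simp add: inner_simps)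
    qed
    \<comment> \<open>Imaginary segment over \<open>x + j v\<close>: every positive root form has
      real part at least \<open>b\<close> there, and its derivative is at most 2 since roots have
      norm below 2. This gives the ratio \<open>2 / b\<close>.\<close>
    have "amplitude (x + real j *\<^sub>R v, 1 *\<^sub>R y) \<le> K1 * amplitude (x + real j *\<^sub>R v, 0 *\<^sub>R y)"
      unfolding K1_def n_def
    proof (rule amplitude_path_le[where \<gamma> = "\<lambda>s. (x + real j *\<^sub>R v, s *\<^sub>R y)" and \<gamma>' = "\<lambda>_. (0, y)"])
      fix s :: real
      show "((\<lambda>s. (x + real j *\<^sub>R v, s *\<^sub>R y)) has_vector_derivative (0, y)) (at s)"
        by (auto intro!: derivative_eq_intros)
      show "norm (fst (0::'a, y)) + norm (snd (0::'a, y)) \<le> 1" using y by simp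
      fix \<alpha> assume \<alpha>: "\<alpha> \<in> Rpos"
      have re: "b \<le> Re (cform (cplx_of \<alpha>) (x + real j *\<^sub>R v, s *\<^sub>R y))"
        using pos[OF \<alpha>] by (simp add: Re_cform_cplx_of)
      then show "cform (cplx_of \<alpha>) (x + real j *\<^sub>R v, s *\<^sub>R y) \<noteq> 0"
        using b(1) by (auto simp: complex_eq_iff)
      have "norm \<alpha> \<le> 2"
        using inner_root_self[OF Rpos_subset[OF \<alpha>]] by (simp add: norm_eq_sqrt_inner sqrt2_less_2 less_imp_le)
      then have "\<bar>\<alpha> \<bullet> y\<bar> \<le> 2 * 1"
        using y by (intro order_trans[OF Cauchy_Schwarz_ineq2] mult_mono) auto
      moreover have "norm (cform (cplx_of \<alpha>) (0, y)) = \<bar>\<alpha> \<bullet> y\<bar>"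
        by (simp add: cmod_def Re_cform_cplx_of Im_cform_cplx_of)
      moreover have "2 / b * b \<le> 2 / b * norm (cform (cplx_of \<alpha>) (x + real j *\<^sub>R v, s *\<^sub>R y))"
        using re b(1) complex_Re_le_cmod[of "cform (cplx_of \<alpha>) (x + real j *\<^sub>R v, s *\<^sub>R y)"]
        by (intro mult_left_mono) auto
      ultimately show "norm (cform (cplx_of \<alpha>) (0, y)) \<le> 2 / b * norm (cform (cplx_of \<alpha>) (x + real j *\<^sub>R v, s *\<^sub>R y))"
        using b(1) by simp
    qed (use b in auto)
    also have "\<dots> = K1 * amplitude (cplx_of (x + real j *\<^sub>R v))"
      by (simp add: cplx_of_def)
    also have "\<dots> \<le> K1 * (C0 * exp (- log_weight (x + real j *\<^sub>R v)))"
      by (intro mult_left_mono K C0 chamber_closed x v) auto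
    also have "\<dots> \<le> K1 * (C0 * exp (- log_weight x))"
    proof (intro mult_left_mono K C0)
      \<comment> \<open>Moving further into the chamber only increases the weight, so the bound at
        the shifted point is as good as one at \<open>x\<close>.\<close>
      have "log_weight x \<le> log_weight (x + real j *\<^sub>R v)"
        using x v by (intro log_weight_mono) (auto simp: chamber_def inner_simps less_imp_le)
      then show "exp (- log_weight (x + real j *\<^sub>R v)) \<le> exp (- log_weight x)" by simp
    qed
    finally have start: "amplitude (x + real j *\<^sub>R v, y) \<le> K1 * C0 * exp (- log_weight x)"
      by simp
    \<comment> \<open>On the circle each root form is at least half of
      \<open>\<alpha> \<bullet> v\<close> in modulus and has derivative at most \<open>N\<close>
      times it; hence the ratio \<open>2 * N\<close> over a parameter length of at most
      \<open>2 * pi\<close>.\<close>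
    have circle: "amplitude ((x, y) + cscale \<zeta> (cplx_of v)) \<le> K2 * (K1 * C0 * exp (- log_weight x))"
      if \<zeta>: "norm \<zeta> = j" for \<zeta>
    proof -
      let ?c = "\<lambda>\<phi>. of_real j * exp (\<i> * of_real \<phi>)"
      let ?c' = "\<lambda>\<phi>. \<i> * of_real j * exp (\<i> * of_real \<phi>)"
      let ?\<gamma> = "\<lambda>\<phi>. (x, y) + cscale (?c \<phi>) (cplx_of v)"
      let ?\<gamma>' = "\<lambda>\<phi>. cscale (?c' \<phi>) (cplx_of v)"
      define T where "T = Arg2pi \<zeta>"
      have T: "0 \<le> T" "T \<le> 2 * pi" "\<zeta> = ?c T"
        using Arg2pi[of \<zeta>] \<zeta> by (auto simp: T_def is_Arg_def)
      have "amplitude (?\<gamma> T) \<le> n * exp (L * n * T) * amplitude (?\<gamma> 0)"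
        unfolding n_def L_def
      proof (rule amplitude_path_le[where \<gamma> = ?\<gamma> and \<gamma>' = ?\<gamma>', OF T(1)])
        fix \<phi> :: real
        have "(?c has_vector_derivative ?c' \<phi>) (at \<phi>)"
          by (rule has_vector_derivative_real_field[where f = "\<lambda>z. of_real j * exp (\<i> * z)"])
             (auto intro!: derivative_eq_intros)
        from has_vector_derivative_add[OF has_vector_derivative_const[of "(x, y)"]
            bounded_linear.has_vector_derivative[OF bounded_linear_cscale this]]
        show "(?\<gamma> has_vector_derivative ?\<gamma>' \<phi>) (at \<phi>)" by simp
        have "norm (?c' \<phi>) * (norm v + 0) \<le> N * norm v"
          using jN by (simp add: norm_mult mult_right_mono)
        then show "norm (fst (?\<gamma>' \<phi>)) + norm (snd (?\<gamma>' \<phi>)) \<le> N * norm v * 2"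
          using norm_fst_cscale_le[of "?c' \<phi>" "cplx_of v"] norm_snd_cscale_le[of "?c' \<phi>" "cplx_of v"]
          by (simp add: cplx_of_def)
        fix \<alpha> assume \<alpha>: "\<alpha> \<in> Rpos"
        define a where "a = \<alpha> \<bullet> v"
        define q where "q = cform (cplx_of \<alpha>) (x, y)"
        have a: "0 < a" using v(2)[OF \<alpha>] by (simp add: a_def)
        have "a / 2 \<le> a * \<bar>norm q / a - j\<bar>"
          using mult_left_mono[OF far[OF \<alpha>], of a] a by (simp add: a_def q_def)
        also have "a * \<bar>norm q / a - j\<bar> = \<bar>a * (norm q / a - j)\<bar>"
          using a by (simp add: abs_mult)
        also have "\<dots> = \<bar>norm q - norm (?c \<phi> * a)\<bar>"
          using a by (simp add: right_diff_distrib norm_mult mult.commute)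
        also have "\<dots> \<le> norm (q + ?c \<phi> * a)"
          using norm_triangle_ineq3[of q "- (?c \<phi> * a)"] by simp
        also have "q + ?c \<phi> * a = cform (cplx_of \<alpha>) (?\<gamma> \<phi>)"
          by (simp add: q_def a_def cform_add_right cform_cscale_right cform_cplx_of)
        finally have low: "a / 2 \<le> norm (cform (cplx_of \<alpha>) (?\<gamma> \<phi>))" .
        then show "cform (cplx_of \<alpha>) (?\<gamma> \<phi>) \<noteq> 0"
          using a by auto
        have "norm (cform (cplx_of \<alpha>) (?\<gamma>' \<phi>)) = j * a"
          using a by (simp add: cform_cscale_right cform_cplx_of norm_mult a_def)
        also have "\<dots> \<le> N * a" using jN a by simp
        also have "\<dots> = 2 * N * (a / 2)" by simp
        also have "\<dots> \<le> 2 * N * norm (cform (cplx_of \<alpha>) (?\<gamma> \<phi>))"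
          using N low by (intro mult_left_mono) auto
        finally show "norm (cform (cplx_of \<alpha>) (?\<gamma>' \<phi>)) \<le> 2 * N * norm (cform (cplx_of \<alpha>) (?\<gamma> \<phi>))" .
      qed (use N in auto)
      also have "\<dots> \<le> K2 * amplitude (?\<gamma> 0)"
        unfolding K2_def using n L T by (intro mult_right_mono mult_left_mono amplitude_nonneg) (auto intro!: mult_left_mono)
      also have "?\<gamma> 0 = (x + real j *\<^sub>R v, y)"
        by (simp add: cscale_cplx_of)
      also have "K2 * amplitude (x + real j *\<^sub>R v, y) \<le> K2 * (K1 * C0 * exp (- log_weight x))"
        by (intro mult_left_mono start K)
      finally show ?thesis unfolding T(3) .
    qed
    have "norm (F w (x, y)) \<le> K2 * (K1 * C0 * exp (- log_weight x))" if w: "w \<in> W" for w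
    proof -
      have lin: "linear w" by (rule orthogonal_transformation_linear[OF W_orthogonal[OF w]])
      have line: "F w ((x, y) + cscale \<zeta> (cplx_of v)) = f (cmap w (x, y) + cscale \<zeta> (cmap w (cplx_of v)))" for \<zeta>
        by (simp only: F_def cmap_line[OF lin])
      have hol: "(\<lambda>\<zeta>. F w ((x, y) + cscale \<zeta> (cplx_of v))) holomorphic_on UNIV"
        unfolding line by (rule gateaux_entire_holomorphic[OF gateaux_entire_f])
      \<comment> \<open>Cauchy's inequality of order 0 is the maximum principle on the disc. Walls
        inside the disc do no harm because \<open>F w\<close> itself is entire.\<close>
      have "norm ((deriv ^^ 0) (\<lambda>\<zeta>. F w ((x, y) + cscale \<zeta> (cplx_of v))) 0)
          \<le> fact 0 * (K2 * (K1 * C0 * exp (- log_weight x))) / real j ^ 0"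
      proof (rule Cauchy_inequality)
        show "(\<lambda>\<zeta>. F w ((x, y) + cscale \<zeta> (cplx_of v))) holomorphic_on ball 0 (real j)"
          by (rule holomorphic_on_subset[OF hol]) simp
        show "continuous_on (cball 0 (real j)) (\<lambda>\<zeta>. F w ((x, y) + cscale \<zeta> (cplx_of v)))"
          by (rule holomorphic_on_imp_continuous_on, rule holomorphic_on_subset[OF hol]) simp
        show "0 < real j" using j(1) by simp
        fix \<zeta> :: complex assume "norm (0 - \<zeta>) = real j"
        then show "norm (F w ((x, y) + cscale \<zeta> (cplx_of v))) \<le> K2 * (K1 * C0 * exp (- log_weight x))"
          by (intro order_trans[OF norm_F_le_amplitude[OF w] circle]) simp
      qed
      then show ?thesis by simp
    qed
    then have "amplitude (x, y) \<le> (\<Sum>w\<in>W. K2 * (K1 * C0 * exp (- log_weight x)))"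
      unfolding amplitude_def by (intro sum_mono)
    then show "amplitude (x, y) \<le> n * (K2 * (K1 * C0)) * exp (- log_weight x)"
      by (simp add: n_def mult.assoc)
  qed
qed

section \<open>Tube bounds and constant coefficient operators\<close>

definition tube_bounded :: "('a complexification \<Rightarrow> complex) \<Rightarrow> bool" where
  "tube_bounded g \<longleftrightarrow> gateaux_entire g \<and>
     (\<exists>\<epsilon>>0. \<exists>C\<ge>0. \<forall>z. norm (snd z) \<le> \<epsilon> \<longrightarrow> norm (g z) \<le> C * exp (- log_weight (fst z)))"

text \<open>The amplitude and the weight are both invariant under \<open>W\<close>, so the estimate
  over the chamber spreads to all real parts.\<close>

lemma tube_bounded_f: "tube_bounded f"
proof -
  obtain C where C: "0 \<le> C"
    "\<And>x y. x \<in> chamber \<Longrightarrow> norm y \<le> 1 \<Longrightarrow> amplitude (x, y) \<le> C * exp (- log_weight x)"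
    by (rule amplitude_tube_chamber) blast
  have "norm (f z) \<le> C * exp (- log_weight (fst z))" if z: "norm (snd z) \<le> 1" for z
  proof -
    obtain w where w: "w \<in> W" "w (fst z) \<in> chamber"
      by (rule W_conjugate_chamber)
    have "norm (f z) \<le> amplitude (cmap w z)"
      unfolding amplitude_W[OF w(1)] by (rule norm_f_le_amplitude)
    also have "cmap w z = (w (fst z), w (snd z))"
      by (simp add: prod_eq_iff)
    also have "amplitude (w (fst z), w (snd z)) \<le> C * exp (- log_weight (w (fst z)))"
      using z W_orthogonal[OF w(1)] by (intro C w) (simp add: orthogonal_transformation_norm)
    finally show ?thesis by (simp add: log_weight_W[OF w(1)])
  qed
  with C(1) show ?thesis
    unfolding tube_bounded_def by (intro conjI gateaux_entire_f exI[of _ "1::real"] exI[of _ C]) auto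
qed

lemma tube_bounded_add:
  assumes "tube_bounded g" "tube_bounded h"
  shows "tube_bounded (\<lambda>z. g z + h z)"
proof -
  obtain \<epsilon> C \<delta> D where g: "0 < \<epsilon>" "0 \<le> C" "\<And>z. norm (snd z) \<le> \<epsilon> \<Longrightarrow> norm (g z) \<le> C * exp (- log_weight (fst z))"
    and h: "0 < \<delta>" "0 \<le> D" "\<And>z. norm (snd z) \<le> \<delta> \<Longrightarrow> norm (h z) \<le> D * exp (- log_weight (fst z))"
    using assms unfolding tube_bounded_def by blast
  have "norm (g z + h z) \<le> (C + D) * exp (- log_weight (fst z))" if "norm (snd z) \<le> min \<epsilon> \<delta>" for z
    using g(3)[of z] h(3)[of z] that norm_triangle_ineq[of "g z" "h z"] by (simp add: distrib_right)
  moreover have "gateaux_entire (\<lambda>z. g z + h z)"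
    using assms by (intro gateaux_entire_add) (auto simp: tube_bounded_def)
  ultimately show ?thesis
    unfolding tube_bounded_def using g(1,2) h(1,2)
    by (intro conjI exI[of _ "min \<epsilon> \<delta>"] exI[of _ "C + D"]) auto
qed

lemma tube_bounded_cmult:
  assumes "tube_bounded g"
  shows "tube_bounded (\<lambda>z. c * g z)"
proof -
  obtain \<epsilon> C where g: "0 < \<epsilon>" "0 \<le> C" "\<And>z. norm (snd z) \<le> \<epsilon> \<Longrightarrow> norm (g z) \<le> C * exp (- log_weight (fst z))"
    using assms unfolding tube_bounded_def by blast
  have "norm (c * g z) \<le> norm c * C * exp (- log_weight (fst z))" if "norm (snd z) \<le> \<epsilon>" for z
    using mult_left_mono[OF g(3)[OF that], of "norm c"] by (simp add: norm_mult mult.assoc)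
  moreover have "gateaux_entire (\<lambda>z. c * g z)"
    using assms by (intro gateaux_entire_cmult) (auto simp: tube_bounded_def)
  ultimately show ?thesis
    unfolding tube_bounded_def using g(1,2)
    by (intro conjI exI[of _ \<epsilon>] exI[of _ "norm c * C"]) auto
qed

text \<open>Cauchy's inequality on a small circle in direction \<open>u\<close>. The tube shrinks to
  half its width, which is why its radius is existential in \<open>tube_bounded\<close>; moving the
  real part by at most 1 costs the factor \<open>exp K\<close>.\<close>

lemma tube_bounded_line_deriv:
  assumes "tube_bounded g"
  shows "tube_bounded (line_deriv u g)"
proof -
  obtain \<epsilon> C where g: "0 < \<epsilon>" "0 \<le> C" "\<And>z. norm (snd z) \<le> \<epsilon> \<Longrightarrow> norm (g z) \<le> C * exp (- log_weight (fst z))"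
    and ge: "gateaux_entire g"
    using assms unfolding tube_bounded_def by blast
  define M where "M = norm (fst u) + norm (snd u)"
  \<comment> \<open>Along the circle the real part then moves by at most 1 and the imaginary part by
    at most \<open>\<epsilon> / 2\<close>; \<open>1 + M\<close> avoids division by 0 when
    \<open>u = 0\<close>.\<close>
  define r where "r = min 1 (\<epsilon> / 2) / (1 + M)"
  define K where "K = (\<Sum>\<alpha>\<in>Rpos. Re (k \<alpha>) * norm \<alpha>)"
  have M: "0 \<le> M" by (simp add: M_def)
  then have r: "0 < r" using g(1) by (simp add: r_def)
  have "r * M \<le> r * (1 + M)" using r by simp
  also have "\<dots> = min 1 (\<epsilon> / 2)" using M by (simp add: r_def)
  finally have rM: "r * M \<le> 1" "r * M \<le> \<epsilon> / 2" by auto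
  have "norm (line_deriv u g z) \<le> C * exp K / r * exp (- log_weight (fst z))" if z: "norm (snd z) \<le> \<epsilon> / 2" for z
  proof -
    have "norm (line_deriv u g z) \<le> (C * exp (K - log_weight (fst z))) / r"
    proof (rule norm_line_deriv_le[OF ge r])
      fix \<zeta> :: complex assume \<zeta>: "norm \<zeta> = r"
      let ?z = "z + cscale \<zeta> u"
      have "norm (snd ?z) \<le> \<epsilon>"
        using norm_snd_cscale_le[of \<zeta> u] rM(2) z norm_triangle_ineq[of "snd z" "snd (cscale \<zeta> u)"]
        by (simp add: \<zeta> M_def)
      then have "norm (g ?z) \<le> C * exp (- log_weight (fst ?z))" by (rule g(3))
      also have "\<dots> \<le> C * exp (K - log_weight (fst z))"
      proof (intro mult_left_mono g)
        have d: "norm (fst z - fst ?z) \<le> 1"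
          using norm_fst_cscale_le[of \<zeta> u] rM(1) by (simp add: \<zeta> M_def)
        have "\<bar>\<alpha> \<bullet> (fst z - fst ?z)\<bar> \<le> norm \<alpha> * 1" for \<alpha>
          using d by (intro order_trans[OF Cauchy_Schwarz_ineq2] mult_left_mono) auto
        then have "(\<Sum>\<alpha>\<in>Rpos. Re (k \<alpha>) * \<bar>\<alpha> \<bullet> (fst z - fst ?z)\<bar>) \<le> K"
          unfolding K_def by (intro sum_mono mult_left_mono Re_k_nonneg) simp_all
        then show "exp (- log_weight (fst ?z)) \<le> exp (K - log_weight (fst z))"
          using log_weight_diff_le[of "fst z" "fst ?z"] by simp
      qed
      finally show "norm (g ?z) \<le> C * exp (K - log_weight (fst z))" .
    qed
    also have "\<dots> = C * exp K / r * exp (- log_weight (fst z))"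
      by (simp add: exp_diff exp_minus field_simps)
    finally show ?thesis .
  qed
  then show ?thesis
    unfolding tube_bounded_def using g(1,2) r
    by (intro conjI gateaux_entire_line_deriv ge exI[of _ "\<epsilon> / 2"] exI[of _ "C * exp K / r"]) auto
qed

text \<open>A bound on the real points alone would not survive composition of operators. The claim
  therefore provides a tube bounded extension of the result, for arbitrary \<open>g\<close>, to
  which the next operator can be applied.\<close>

lemma tube_bounded_symbol_op:
  assumes "symbol_op p D" "tube_bounded g"
  shows "\<exists>h. tube_bounded h \<and> D (\<lambda>y. g (cplx_of y)) = (\<lambda>y. h (cplx_of y))"
  using assms
proof (induction arbitrary: g rule: symbol_op.induct)
  case (const c)
  then show ?case
    by (intro exI[of _ "\<lambda>z. c * g z"] conjI tube_bounded_cmult) auto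
next
  case (linear \<xi>)
  then have "gateaux_entire g" by (simp add: tube_bounded_def)
  then have "dir_deriv \<xi> (\<lambda>y. g (cplx_of y)) = (\<lambda>y. line_deriv (cplx_of \<xi>) g (cplx_of y))"
    by (simp add: fun_eq_iff dir_deriv_cplx_of dir_deriv_eq_line_deriv)
  with tube_bounded_line_deriv[OF linear] show ?case by blast
next
  case (add p D q D')
  then obtain h h' where "tube_bounded h" "D (\<lambda>y. g (cplx_of y)) = (\<lambda>y. h (cplx_of y))"
    "tube_bounded h'" "D' (\<lambda>y. g (cplx_of y)) = (\<lambda>y. h' (cplx_of y))"
    by meson
  then show ?case
    by (intro exI[of _ "\<lambda>z. h z + h' z"] conjI tube_bounded_add) auto
next
  case (mult p D q D')
  from mult.IH(2)[OF mult.prems] obtain h' where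
    "tube_bounded h'" "D' (\<lambda>y. g (cplx_of y)) = (\<lambda>y. h' (cplx_of y))" by blast
  with mult.IH(1)[of h'] show ?case by simp
qed

end

theorem theorem2p4:
  fixes R Rpos :: "'a::euclidean_space set"
    and k :: "'a \<Rightarrow> complex"
    and Exp\<^sub>k :: "'a complexification \<Rightarrow> 'a complexification \<Rightarrow> complex"
    and \<mu> :: 'a
    and p :: "'a \<Rightarrow> complex"
    and p_diff :: "('a \<Rightarrow> complex) \<Rightarrow> 'a \<Rightarrow> complex"
  assumes "normalized_root_system R"
    and "positive_roots R Rpos"
    and "multiplicity_function R k"
    and "\<forall>\<alpha>\<in>R. Re (k \<alpha>) \<ge> 0"
    and "is_dunkl_kernel Rpos k Exp\<^sub>k"
    and "\<mu> \<in> regular R"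
    and "symbol_op p p_diff"
  shows "\<exists>C\<ge>0. \<forall>x. norm (p_diff (\<lambda>y. Exp\<^sub>k (cscale \<i> (cplx_of \<mu>)) (cplx_of y)) x)
                     \<le> C * norm (Omega_neg_half Rpos k x)"
proof -
  have "dunkl_eigenfunction Rpos k (cscale \<i> (cplx_of \<mu>)) (Exp\<^sub>k (cscale \<i> (cplx_of \<mu>)))"
    using assms(5) unfolding is_dunkl_kernel_def by blast
  then interpret dunkl_solution R Rpos k "Exp\<^sub>k (cscale \<i> (cplx_of \<mu>))" \<mu>
    using assms by unfold_locales
  obtain h where h: "tube_bounded h"
    "p_diff (\<lambda>y. Exp\<^sub>k (cscale \<i> (cplx_of \<mu>)) (cplx_of y)) = (\<lambda>y. h (cplx_of y))"
    using tube_bounded_symbol_op[OF assms(7) tube_bounded_f] by blast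
  then obtain \<epsilon> C where "0 < \<epsilon>" "0 \<le> C"
    and C: "\<And>z. norm (snd z) \<le> \<epsilon> \<Longrightarrow> norm (h z) \<le> C * exp (- log_weight (fst z))"
    unfolding tube_bounded_def by blast
  \<comment> \<open>Real points lie in every tube, whatever width is left after the
    differentiations.\<close>
  have "norm (h (cplx_of x)) \<le> C * exp (- log_weight x)" for x
    using C[of "cplx_of x"] \<open>0 < \<epsilon>\<close> by (simp add: cplx_of_def)
  with \<open>0 \<le> C\<close> show ?thesis
    unfolding h(2) norm_Omega_neg_half by blast
qed

end
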